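(* Let $\mathcal{AF}_D$ be the vector space of aromatic forests decorated by a set $D$ (or the space $\mathcal{AF}_g$ of grafted forests, or the space $\mathcal{EF}$ of exotic forests), let $\diamond$ be the Grossman–Larson product and $\circledast$ the product dual to the Connes–Kreimer coproduct $\Delta_{CK}$. Let $A_\sigma:\mathcal{AF}_D\to\mathcal{AF}_D$ be the linear map given on basis forests by $A_\sigma(\pi,\alpha)=\sigma(\pi,\alpha)\,(\pi,\alpha)$, where $\sigma(\pi,\alpha)$ is the size of the automorphism group of $(\pi,\alpha)$. Then $$A_\sigma:(\mathcal{AF}_D,\diamond)\to(\mathcal{AF}_D,\circledast)$$ is an algebra isomorphism.
   Context: **Aromatic forests.** An aromatic forest is a finite directed graph (self-loops allowed), up to isomorphism, in which every vertex has at most one outgoing edge, and which is either empty or has at least one root (vertex without outgoing edge). $AF$ denotes the set of aromatic forests. Components without a root (they contain a cycle) are called aromas. For a set $D$, $AF_D$ is the set of isomorphism classes of pairs $(\pi,\alpha)$, $\pi\in AF$, $\alpha:V(\pi)\to D$; an isomorphism $(\pi_1,\alpha_1)\to(\pi_2,\alpha_2)$ is a graph isomorphism $\varphi:\pi_1\to\pi_2$ with $\alpha_1=\alpha_2\circ\varphi$. $\mathcal{AF}_D$ is the real vector space with basis $AF_D$. Concatenation is disjoint union. **Grossman–Larson product.** Grafting $\curvearrowright$: for an aromatic tree $\tau$ (exactly one root, possibly with aromas) $\tau\curvearrowright\pi$ is the sum over all ways to attach the root of $\tau$ to a vertex of $\pi$ (the aromas of $\tau$ are added by disjoint union), extended by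 $(\tau\cdot\pi_1)\curvearrowright\pi_2=\tau\curvearrowright(\pi_1\curvearrowright\pi_2)-(\tau\curvearrowright\pi_1)\curvearrowright\pi_2$. The product $\diamond$ represents composition: $\pi_1\curvearrowright(\pi_2\curvearrowright\cdot)=(\pi_1\diamond\pi_2)\curvearrowright\cdot$. Explicitly, $\pi_1\diamond\pi_2$ is the sum, over all maps from the set of roots of $\pi_1$ to $V(\pi_2)\sqcup\{\ast\}$, of the decorated forest obtained from the disjoint union of $\pi_1$ and $\pi_2$ by adding an edge from each root of $\pi_1$ to its image vertex (no edge if the image is $\ast$). **Connes–Kreimer coproduct.** $\Delta_{CK}(\pi,\alpha)=\sum_{\pi_0\subset\pi}(\pi\setminus\pi_0,\alpha|_{\pi\setminus\pi_0})\otimes(\pi_0,\alpha|_{\pi_0})$, the sum over all induced subgraphs $\pi_0$ on vertex subsets with $\pi_0\in AF$, $\pi\setminus\pi_0\in AF$, and no edge of $\pi$ going from $\pi_0$ to $\pi\setminus\pi_0$. The dual product $\circledast$ is defined by: the coefficient of $\pi$ in $\pi_1\circledast\pi_2$ equals the coefficient of $\pi_1\otimes\pi_2$ in $\Delta_{CK}(\pi)$. **Grafted forests.** $\mathcal{AF}_g$ is spanned by the forests decorated by $D=\{\bullet,\times\}$ in which every $\times$-vertex (grafted vertex) has no incoming edge; equivalently the quotient of $\mathcal{AF}_{\{\bullet,\times\}}$ by the span of the forests in which some $\times$-vertex has an incoming edge. So in grafting and in $\diamond$, attaching to a $\times$-vertex gives zero. **Exotic forests.** $\mathcal{EF}$ is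 spanned by isomorphism classes of grafted forests together with a perfect matching of the grafted vertices (a matched pair is called a liana); isomorphisms preserve the matching. In $\diamond$, the matching of the result is the union of the matchings. In $\Delta_{CK}$ only those $\pi_0$ are used for which no liana has one vertex in $\pi_0$ and the other in $\pi\setminus\pi_0$. *)

theory Defs
  imports "HOL-Analysis.Finite_Function_Topology" "HOL-Library.Poly_Mapping" "HOL-Library.FuncSet"
    "HOL-Library.Disjoint_Sets"
begin

section \<open>Concrete decorated graphs\<close>

text \<open>One record serves for all three kinds of forests: the field \<open>lianas\<close> is the set of matched pairs
  of an exotic forest, and is required to be empty for decorated and for grafted forests.
  The values of \<open>dec\<close> outside \<open>verts\<close> carry no information; isomorphisms ignore them.\<close>

record ('v, 'd) dgraph =
  verts :: "'v set"
  edges :: "('v \<times> 'v) set"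
  dec :: "'v \<Rightarrow> 'd"
  lianas :: "'v set set"

definition roots :: "('v, 'd) dgraph \<Rightarrow> 'v set" where
  "roots G = {v \<in> verts G. \<forall>w. (v, w) \<notin> edges G}"

definition aromatic_forest :: "('v, 'd) dgraph \<Rightarrow> bool" where
  "aromatic_forest G \<longleftrightarrow>
     finite (verts G) \<and> edges G \<subseteq> verts G \<times> verts G \<and> single_valued (edges G) \<and>
     (verts G = {} \<or> roots G \<noteq> {})"

definition empty_graph :: "('v, 'd) dgraph" where
  "empty_graph = \<lparr>verts = {}, edges = {}, dec = (\<lambda>_. undefined), lianas = {}\<rparr>"

definition induced :: "('v, 'd) dgraph \<Rightarrow> 'v set \<Rightarrow> ('v, 'd) dgraph" where
  "induced G S = \<lparr>verts = S, edges = edges G \<inter> S \<times> S, dec = dec G,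
                  lianas = {l \<in> lianas G. l \<subseteq> S}\<rparr>"

text \<open>Isomorphisms are taken in \<open>extensional\<close>, so that they are determined by their values on
  vertices and can be counted.\<close>

definition isos :: "('v, 'd) dgraph \<Rightarrow> ('w, 'd) dgraph \<Rightarrow> ('v \<Rightarrow> 'w) set" where
  "isos G H = {\<phi> \<in> extensional (verts G).
     bij_betw \<phi> (verts G) (verts H) \<and>
     edges H = map_prod \<phi> \<phi> ` edges G \<and>
     (\<forall>v \<in> verts G. dec G v = dec H (\<phi> v)) \<and>
     lianas H = (\<lambda>l. \<phi> ` l) ` lianas G}"

section \<open>Isomorphism classes\<close>

text \<open>Every finite graph, whatever its vertex type, is isomorphic to one with vertices in \<^typ>\<open>nat\<close>;
  its isomorphism class is represented by the set of all those copies.\<close>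

type_synonym 'd forest = "(nat, 'd) dgraph set"

definition iso_class :: "('v, 'd) dgraph \<Rightarrow> 'd forest" where
  "iso_class G = {H. isos G H \<noteq> {}}"

definition rep :: "'d forest \<Rightarrow> (nat, 'd) dgraph" where
  "rep p = (SOME G. G \<in> p)"

definition symmetry :: "'d forest \<Rightarrow> nat" where
  "symmetry p = card (isos (rep p) (rep p))"

definition AF :: "'d set \<Rightarrow> 'd forest set" where
  "AF D = {iso_class G | G :: (nat, 'd) dgraph.
             aromatic_forest G \<and> dec G ` verts G \<subseteq> D \<and> lianas G = {}}"

datatype vertex_kind = Bullet | Cross

definition grafted_forest :: "('v, vertex_kind) dgraph \<Rightarrow> bool" where
  "grafted_forest G \<longleftrightarrow> aromatic_forest G \<and> (\<forall>(v, w) \<in> edges G. dec G w \<noteq> Cross)"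

definition AFg :: "vertex_kind forest set" where
  "AFg = {iso_class G | G :: (nat, vertex_kind) dgraph. grafted_forest G \<and> lianas G = {}}"

definition perfect_matching :: "'v set \<Rightarrow> 'v set set \<Rightarrow> bool" where
  "perfect_matching A M \<longleftrightarrow> partition_on A M \<and> (\<forall>l \<in> M. card l = 2)"

definition EF :: "vertex_kind forest set" where
  "EF = {iso_class G | G :: (nat, vertex_kind) dgraph.
           grafted_forest G \<and> perfect_matching {v \<in> verts G. dec G v = Cross} (lianas G)}"

section \<open>Vector spaces with a given basis of forests\<close>

definition span_forests :: "'d forest set \<Rightarrow> ('d forest \<Rightarrow>\<^sub>0 real) set" where
  "span_forests B = {x. Poly_Mapping.keys x \<subseteq> B}"

abbreviation basis :: "'a \<Rightarrow> ('a \<Rightarrow>\<^sub>0 real)" where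
  "basis p \<equiv> Poly_Mapping.single p 1"

definition linear_extend :: "('a \<Rightarrow> 'b::real_vector) \<Rightarrow> ('a \<Rightarrow>\<^sub>0 real) \<Rightarrow> 'b" where
  "linear_extend f x = (\<Sum>p \<in> Poly_Mapping.keys x. Poly_Mapping.lookup x p *\<^sub>R f p)"

definition bilinear_extend ::
    "('a \<Rightarrow> 'a \<Rightarrow> 'b::real_vector) \<Rightarrow> ('a \<Rightarrow>\<^sub>0 real) \<Rightarrow> ('a \<Rightarrow>\<^sub>0 real) \<Rightarrow> 'b" where
  "bilinear_extend f x y = linear_extend (\<lambda>p. linear_extend (f p) y) x"

definition empty_forest :: "'d forest \<Rightarrow>\<^sub>0 real" where
  "empty_forest = basis (iso_class (empty_graph :: (nat, 'd) dgraph))"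

definition A_sigma :: "('d forest \<Rightarrow>\<^sub>0 real) \<Rightarrow> ('d forest \<Rightarrow>\<^sub>0 real)" where
  "A_sigma = linear_extend (\<lambda>p. real (symmetry p) *\<^sub>R basis p)"

section \<open>The Grossman--Larson product\<close>

text \<open>A map \<open>f\<close> from the roots of \<open>G\<close> to the vertices of \<open>H\<close> or \<open>\<ast>\<close>, with \<open>None\<close> in the role
  of \<open>\<ast>\<close>.\<close>

definition attach_maps :: "('v, 'd) dgraph \<Rightarrow> ('w, 'd) dgraph \<Rightarrow> ('v \<Rightarrow> 'w option) set" where
  "attach_maps G H = roots G \<rightarrow>\<^sub>E insert None (Some ` verts H)"

definition attach ::
    "('v, 'd) dgraph \<Rightarrow> ('w, 'd) dgraph \<Rightarrow> ('v \<Rightarrow> 'w option) \<Rightarrow> ('v + 'w, 'd) dgraph" where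
  "attach G H f =
     \<lparr>verts = verts G <+> verts H,
      edges = map_prod Inl Inl ` edges G \<union> map_prod Inr Inr ` edges H
                \<union> {(Inl r, Inr v) | r v. r \<in> roots G \<and> f r = Some v},
      dec = case_sum (dec G) (dec H),
      lianas = (\<lambda>l. Inl ` l) ` lianas G \<union> (\<lambda>l. Inr ` l) ` lianas H\<rparr>"

text \<open>The product on the span of the forests in \<open>B\<close>: a summand outside \<open>B\<close> is zero. Nothing is
  dropped when \<open>B\<close> is \<^term>\<open>AF D\<close>; for \<^term>\<open>AFg\<close> and \<^term>\<open>EF\<close> the dropped summands are those in
  which a root is attached to a grafted vertex.\<close>

definition GL_basis :: "'d forest set \<Rightarrow> 'd forest \<Rightarrow> 'd forest \<Rightarrow> ('d forest \<Rightarrow>\<^sub>0 real)" where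
  "GL_basis B p q =
     (\<Sum>f \<in> attach_maps (rep p) (rep q).
        if iso_class (attach (rep p) (rep q) f) \<in> B
        then basis (iso_class (attach (rep p) (rep q) f)) else 0)"

definition GL_product ::
    "'d forest set \<Rightarrow> ('d forest \<Rightarrow>\<^sub>0 real) \<Rightarrow> ('d forest \<Rightarrow>\<^sub>0 real) \<Rightarrow> ('d forest \<Rightarrow>\<^sub>0 real)" where
  "GL_product B = bilinear_extend (GL_basis B)"

section \<open>The Connes--Kreimer coproduct and its dual product\<close>

text \<open>The last condition (no liana is cut) is vacuous when there are no lianas.\<close>

definition CK_subsets :: "('v, 'd) dgraph \<Rightarrow> 'v set set" where
  "CK_subsets G = {S. S \<subseteq> verts G \<and>
     aromatic_forest (induced G S) \<and> aromatic_forest (induced G (verts G - S)) \<and>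
     edges G \<inter> S \<times> (verts G - S) = {} \<and>
     (\<forall>l \<in> lianas G. l \<subseteq> S \<or> l \<subseteq> verts G - S)}"

text \<open>The tensor square of a space with basis \<open>B\<close> is identified with the space with basis
  \<open>B \<times> B\<close>.\<close>

definition CK_coproduct :: "'d forest \<Rightarrow> ('d forest \<times> 'd forest \<Rightarrow>\<^sub>0 real)" where
  "CK_coproduct p =
     (\<Sum>S \<in> CK_subsets (rep p).
        basis (iso_class (induced (rep p) (verts (rep p) - S)), iso_class (induced (rep p) S)))"

text \<open>For forests \<open>p\<^sub>1\<close> and \<open>p\<^sub>2\<close> in one of the sets \<open>B\<close> considered here, the coefficient below
  is nonzero for finitely many \<open>p\<close> only, because \<open>p\<^sub>1\<close> and \<open>p\<^sub>2\<close> fix the number of vertices of \<open>p\<close>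
  and the decorations that occur.\<close>

definition CK_dual_basis :: "'d forest set \<Rightarrow> 'd forest \<Rightarrow> 'd forest \<Rightarrow> ('d forest \<Rightarrow>\<^sub>0 real)" where
  "CK_dual_basis B p\<^sub>1 p\<^sub>2 =
     Abs_poly_mapping (\<lambda>p. if p \<in> B then Poly_Mapping.lookup (CK_coproduct p) (p\<^sub>1, p\<^sub>2) else 0)"

definition CK_dual_product ::
    "'d forest set \<Rightarrow> ('d forest \<Rightarrow>\<^sub>0 real) \<Rightarrow> ('d forest \<Rightarrow>\<^sub>0 real) \<Rightarrow> ('d forest \<Rightarrow>\<^sub>0 real)" where
  "CK_dual_product B = bilinear_extend (CK_dual_basis B)"

section \<open>Algebras and their isomorphisms\<close>

text \<open>The classes \<^class>\<open>real_algebra_1\<close> and the HOL-Algebra locales do not fit: several products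
  live on one type, the carriers are proper subspaces, and the products are not commutative.\<close>

locale algebra_on =
  fixes V :: "'a::real_vector set"
    and mult :: "'a \<Rightarrow> 'a \<Rightarrow> 'a"
    and unit :: 'a
  assumes subspace: "subspace V"
    and mult_closed: "\<lbrakk>x \<in> V; y \<in> V\<rbrakk> \<Longrightarrow> mult x y \<in> V"
    and unit_closed: "unit \<in> V"
    and mult_add_left: "\<lbrakk>x \<in> V; y \<in> V; z \<in> V\<rbrakk> \<Longrightarrow> mult (x + y) z = mult x z + mult y z"
    and mult_add_right: "\<lbrakk>x \<in> V; y \<in> V; z \<in> V\<rbrakk> \<Longrightarrow> mult x (y + z) = mult x y + mult x z"
    and mult_scale_left: "\<lbrakk>x \<in> V; y \<in> V\<rbrakk> \<Longrightarrow> mult (c *\<^sub>R x) y = c *\<^sub>R mult x y"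
    and mult_scale_right: "\<lbrakk>x \<in> V; y \<in> V\<rbrakk> \<Longrightarrow> mult x (c *\<^sub>R y) = c *\<^sub>R mult x y"
    and mult_assoc: "\<lbrakk>x \<in> V; y \<in> V; z \<in> V\<rbrakk> \<Longrightarrow> mult (mult x y) z = mult x (mult y z)"
    and mult_unit_left: "x \<in> V \<Longrightarrow> mult unit x = x"
    and mult_unit_right: "x \<in> V \<Longrightarrow> mult x unit = x"

locale algebra_isomorphism =
  source: algebra_on V mult unit + target: algebra_on W mult' unit'
  for V :: "'a::real_vector set" and mult unit
    and W :: "'b::real_vector set" and mult' unit' +
  fixes f :: "'a \<Rightarrow> 'b"
  assumes add: "\<lbrakk>x \<in> V; y \<in> V\<rbrakk> \<Longrightarrow> f (x + y) = f x + f y"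
    and scale: "x \<in> V \<Longrightarrow> f (c *\<^sub>R x) = c *\<^sub>R f x"
    and bij: "bij_betw f V W"
    and mult: "\<lbrakk>x \<in> V; y \<in> V\<rbrakk> \<Longrightarrow> f (mult x y) = mult' (f x) (f y)"
    and unit: "f unit = unit'"

end

theory Submission
  imports Defs
begin

text \<open>Fix forests \<open>G\<close>, \<open>H\<close> and \<open>K\<close>. Pairs consisting of a way \<open>f\<close> to attach the roots of \<open>G\<close> to \<open>H\<close> and an
  isomorphism from the resulting forest to \<open>K\<close> correspond to triples consisting of an admissible cut \<open>S\<close>
  of \<open>K\<close>, an isomorphism from \<open>G\<close> to the part of \<open>K\<close> outside \<open>S\<close> and one from \<open>H\<close> to \<open>S\<close>. Since a
  nonempty set of isomorphisms is a torsor under the automorphism group, counting both sides gives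
  \<open>\<sigma>(K) \<cdot> #{f} = \<sigma>(G) \<sigma>(H) \<cdot> #{S}\<close>, which is multiplicativity of \<open>A\<^sub>\<sigma>\<close> on basis elements.
  The same identity shows that only finitely many \<open>K\<close> occur in \<open>G \<circledast> H\<close>, and that the number of cuts
  depends only on the isomorphism class of \<open>K\<close>. Coassociativity is elementary for the cuts, and
  the algebra axioms for the Grossman--Larson product are transported along the bijection \<open>A\<^sub>\<sigma>\<close>.\<close>

section \<open>Linear extension\<close>

lemma lookup_scaleR [simp]:
  fixes x :: "'a \<Rightarrow>\<^sub>0 'b::real_vector"
  shows "Poly_Mapping.lookup (c *\<^sub>R x) p = c *\<^sub>R Poly_Mapping.lookup x p"
proof -
  \<comment> \<open>Scaling is defined through \<open>Abs_poly_mapping\<close>, so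
    \<open>lookup\<close> recovers the scaled function only once its support is known to be
    finite.\<close>
  have "finite {i. c *\<^sub>R Poly_Mapping.lookup x i \<noteq> 0}"
    by (rule finite_subset [OF _ finite_keys [of x]]) (auto simp: in_keys_iff)
  then show ?thesis
    by (simp add: scaleR_poly_mapping_def)
qed

text \<open>Vectors with different supports are compared over a common finite index set; the added
  terms have coefficient zero.\<close>

lemma linear_extend_superset:
  assumes "finite S" "Poly_Mapping.keys x \<subseteq> S"
  shows "linear_extend f x = (\<Sum>p\<in>S. Poly_Mapping.lookup x p *\<^sub>R f p)"
  unfolding linear_extend_def using assms
  by (intro sum.mono_neutral_left) (auto simp: in_keys_iff)

lemma linear_linear_extend: "linear (linear_extend f)"
proof (rule linearI)
  fix x y :: "'a \<Rightarrow>\<^sub>0 real"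
  let ?S = "Poly_Mapping.keys x \<union> Poly_Mapping.keys y"
  have "linear_extend f z = (\<Sum>p\<in>?S. Poly_Mapping.lookup z p *\<^sub>R f p)" if "z \<in> {x, y, x + y}" for z
    using that keys_add [of x y] by (intro linear_extend_superset) auto
  then show "linear_extend f (x + y) = linear_extend f x + linear_extend f y"
    by (simp add: lookup_add scaleR_add_left sum.distrib)
next
  fix c :: real and x :: "'a \<Rightarrow>\<^sub>0 real"
  have "Poly_Mapping.keys (c *\<^sub>R x) \<subseteq> Poly_Mapping.keys x"
    by (auto simp: in_keys_iff)
  then show "linear_extend f (c *\<^sub>R x) = c *\<^sub>R linear_extend f x"
    using linear_extend_superset [of "Poly_Mapping.keys x" "c *\<^sub>R x" f]
    by (simp add: linear_extend_def scaleR_sum_right)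
qed

lemma linear_extend_basis [simp]: "linear_extend f (basis p) = f p"
  by (simp add: linear_extend_def)

lemma linear_extend_add: "linear_extend (\<lambda>p. f p + g p) x = linear_extend f x + linear_extend g x"
  by (simp add: linear_extend_def scaleR_add_right sum.distrib)

lemma linear_extend_scale: "linear_extend (\<lambda>p. c *\<^sub>R f p) x = c *\<^sub>R linear_extend f x"
  by (simp add: linear_extend_def scaleR_sum_right mult.commute)

lemma bilinear_extend_basis [simp]: "bilinear_extend f (basis p) (basis q) = f p q"
  by (simp add: bilinear_extend_def)

lemma linear_bilinear_extend_left: "linear (\<lambda>x. bilinear_extend f x y)"
  unfolding bilinear_extend_def by (rule linear_linear_extend)

lemma linear_bilinear_extend_right: "linear (bilinear_extend f x)"
proof (rule linearI)
  show "bilinear_extend f x (y + z) = bilinear_extend f x y + bilinear_extend f x z" for y z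
    by (simp add: bilinear_extend_def linear_add [OF linear_linear_extend] linear_extend_add)
  show "bilinear_extend f x (c *\<^sub>R y) = c *\<^sub>R bilinear_extend f x y" for c y
    by (simp add: bilinear_extend_def linear_scale [OF linear_linear_extend] linear_extend_scale)
qed

section \<open>Reduction of linear and bilinear identities to basis forests\<close>

lemma basis_expansion: "x = (\<Sum>p\<in>Poly_Mapping.keys x. Poly_Mapping.lookup x p *\<^sub>R basis p)"
proof (rule poly_mapping_eqI)
  fix q
  have "(\<Sum>p\<in>Poly_Mapping.keys x. Poly_Mapping.lookup x p * (1 when p = q)) = Poly_Mapping.lookup x q"
  proof -
    have "(\<Sum>p\<in>Poly_Mapping.keys x. Poly_Mapping.lookup x p * (1 when p = q)) =
          (\<Sum>p\<in>Poly_Mapping.keys x. if q = p then Poly_Mapping.lookup x p else 0)"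
      by (intro sum.cong) (auto simp: when_def)
    then show ?thesis
      by (simp add: in_keys_iff)
  qed
  then show "Poly_Mapping.lookup x q =
      Poly_Mapping.lookup (\<Sum>p\<in>Poly_Mapping.keys x. Poly_Mapping.lookup x p *\<^sub>R basis p) q"
    by (simp add: lookup_sum lookup_single)
qed

text \<open>Testing on \<open>B\<close> suffices because the expansion of \<open>x\<close> involves
  no other basis forests.\<close>

lemma linear_eq_on_span_forests:
  assumes "linear f" "linear g" "x \<in> span_forests B" "\<And>p. p \<in> B \<Longrightarrow> f (basis p) = g (basis p)"
  shows "f x = g x"
proof -
  have "h x = (\<Sum>p\<in>Poly_Mapping.keys x. Poly_Mapping.lookup x p *\<^sub>R h (basis p))" if "linear h"
    for h :: "_ \<Rightarrow> 'b"
    by (subst basis_expansion [of x]) (simp only: linear_sum [OF that] linear_scale [OF that])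
  from this [OF assms(1)] this [OF assms(2)] show ?thesis
    using assms(3,4) by (auto simp: span_forests_def intro!: sum.cong)
qed

lemma subspace_span_forests: "subspace (span_forests B)"
proof (rule subspaceI)
  show "x + y \<in> span_forests B" if "x \<in> span_forests B" "y \<in> span_forests B" for x y
    using that keys_add [of x y] unfolding span_forests_def by blast
  show "c *\<^sub>R x \<in> span_forests B" if "x \<in> span_forests B" for c x
    using that by (auto simp: span_forests_def in_keys_iff subset_iff)
qed (simp add: span_forests_def)

lemma linear_extend_in_subspace:
  assumes "subspace V" "\<And>p. p \<in> Poly_Mapping.keys x \<Longrightarrow> f p \<in> V"
  shows "linear_extend f x \<in> V"
  unfolding linear_extend_def using assms by (intro subspace_sum subspace_scale) auto

lemma bilinear_extend_in_subspace:
  assumes "subspace V" "x \<in> span_forests B" "y \<in> span_forests B"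
    "\<And>p q. p \<in> B \<Longrightarrow> q \<in> B \<Longrightarrow> f p q \<in> V"
  shows "bilinear_extend f x y \<in> V"
  unfolding bilinear_extend_def using assms
  by (intro linear_extend_in_subspace) (auto simp: span_forests_def)

lemma bilinear_extend_scale_left:
  "bilinear_extend f (c *\<^sub>R x) y = c *\<^sub>R bilinear_extend f x y"
  using linear_scale [OF linear_bilinear_extend_left [of f y]] by simp

lemma bilinear_extend_scale_right:
  "bilinear_extend f x (c *\<^sub>R y) = c *\<^sub>R bilinear_extend f x y"
  by (rule linear_scale [OF linear_bilinear_extend_right])

text \<open>The assumption is associativity on basis forests, with \<open>f p q\<close> in place of
  the product of two basis vectors. The arguments are freed one at a time, \<open>z\<close> first,
  then \<open>y\<close>, then \<open>x\<close>; each time both sides are linear in the freed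
  argument.\<close>

lemma bilinear_extend_assoc:
  assumes "\<And>p q r. p \<in> B \<Longrightarrow> q \<in> B \<Longrightarrow> r \<in> B \<Longrightarrow>
      bilinear_extend f (f p q) (basis r) = bilinear_extend f (basis p) (f q r)"
    and xyz: "x \<in> span_forests B" "y \<in> span_forests B" "z \<in> span_forests B"
  shows "bilinear_extend f (bilinear_extend f x y) z = bilinear_extend f x (bilinear_extend f y z)"
proof -
  note lin = linear_bilinear_extend_left linear_bilinear_extend_right
    linear_compose [OF linear_bilinear_extend_left linear_bilinear_extend_left, unfolded comp_def]
    linear_compose [OF linear_bilinear_extend_left linear_bilinear_extend_right, unfolded comp_def]
    linear_compose [OF linear_bilinear_extend_right linear_bilinear_extend_left, unfolded comp_def]
    linear_compose [OF linear_bilinear_extend_right linear_bilinear_extend_right, unfolded comp_def]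
  let ?m = "bilinear_extend f"
  have 1: "?m (?m (basis p) (basis q)) z = ?m (basis p) (?m (basis q) z)" if "p \<in> B" "q \<in> B" for p q
    by (rule linear_eq_on_span_forests [OF _ _ xyz(3), of "\<lambda>z. ?m (?m (basis p) (basis q)) z"
          "\<lambda>z. ?m (basis p) (?m (basis q) z)"])
      (use that assms(1) in \<open>simp_all add: lin\<close>)
  have 2: "?m (?m (basis p) y) z = ?m (basis p) (?m y z)" if "p \<in> B" for p
    by (rule linear_eq_on_span_forests [OF _ _ xyz(2), of "\<lambda>y. ?m (?m (basis p) y) z"
          "\<lambda>y. ?m (basis p) (?m y z)"])
      (use that 1 in \<open>simp_all add: lin\<close>)
  show ?thesis
    by (rule linear_eq_on_span_forests [OF _ _ xyz(1), of "\<lambda>x. ?m (?m x y) z" "\<lambda>x. ?m x (?m y z)"])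
      (use 2 in \<open>simp_all add: lin\<close>)
qed

text \<open>With one factor a basis vector, a single sum over the support of the other remains. In
  this form iterated products are compared with iterated cuts.\<close>

lemma lookup_bilinear_extend_basis_right:
  "Poly_Mapping.lookup (bilinear_extend f x (basis r)) k =
     (\<Sum>p\<in>Poly_Mapping.keys x. Poly_Mapping.lookup x p * Poly_Mapping.lookup (f p r) k)"
  by (simp add: bilinear_extend_def linear_extend_def [of _ x] lookup_sum)

lemma lookup_bilinear_extend_basis_left:
  "Poly_Mapping.lookup (bilinear_extend f (basis r) x) k =
     (\<Sum>p\<in>Poly_Mapping.keys x. Poly_Mapping.lookup x p * Poly_Mapping.lookup (f r p) k)"
  by (simp add: bilinear_extend_def linear_extend_def [of _ x] lookup_sum)

text \<open>\<open>A_sigma\<close> is diagonal in the basis of forests, so its identities can be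
  checked coefficient by coefficient.\<close>

lemma lookup_A_sigma: "Poly_Mapping.lookup (A_sigma x) p = symmetry p * Poly_Mapping.lookup x p"
proof -
  have "(\<Sum>q\<in>Poly_Mapping.keys x. Poly_Mapping.lookup x q * (real (symmetry q) * (1 when q = p))) =
        (\<Sum>q\<in>Poly_Mapping.keys x. if p = q then symmetry q * Poly_Mapping.lookup x q else 0)"
    by (intro sum.cong) (auto simp: when_def)
  then show ?thesis
    by (simp add: A_sigma_def linear_extend_def lookup_sum lookup_single in_keys_iff mult.assoc)
qed

section \<open>Isomorphisms\<close>

text \<open>Isomorphisms without extensionality, which composites and inverses need not inherit.
  Isomorphisms are constructed in this form; \<open>restrict\<close> turns them into elements of
  \<open>isos\<close> when they are counted.\<close>

definition iso_on :: "('v \<Rightarrow> 'w) \<Rightarrow> ('v, 'd) dgraph \<Rightarrow> ('w, 'd) dgraph \<Rightarrow> bool" where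
  "iso_on \<phi> G H \<longleftrightarrow>
     bij_betw \<phi> (verts G) (verts H) \<and>
     edges H = map_prod \<phi> \<phi> ` edges G \<and>
     (\<forall>v \<in> verts G. dec G v = dec H (\<phi> v)) \<and>
     lianas H = (\<lambda>l. \<phi> ` l) ` lianas G"

text \<open>Under this condition the action of a map on edges and lianas depends only on its values
  on vertices. It is weaker than being a forest, so that it can be checked directly for the result
  of an attachment.\<close>

definition well_formed :: "('v, 'd) dgraph \<Rightarrow> bool" where
  "well_formed G \<longleftrightarrow> edges G \<subseteq> verts G \<times> verts G \<and> lianas G \<subseteq> Pow (verts G)"

lemma isos_iff: "\<phi> \<in> isos G H \<longleftrightarrow> \<phi> \<in> extensional (verts G) \<and> iso_on \<phi> G H"
  by (auto simp: isos_def iso_on_def)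

lemma iso_on_cong:
  assumes "well_formed G" "\<And>v. v \<in> verts G \<Longrightarrow> \<phi> v = \<psi> v"
  shows "iso_on \<phi> G H \<longleftrightarrow> iso_on \<psi> G H"
proof -
  have "map_prod \<phi> \<phi> ` edges G = map_prod \<psi> \<psi> ` edges G"
    using assms by (intro image_cong) (auto simp: well_formed_def)
  moreover have "(\<lambda>l. \<phi> ` l) ` lianas G = (\<lambda>l. \<psi> ` l) ` lianas G"
    using assms by (intro image_cong refl) (auto simp: well_formed_def)
  moreover have "bij_betw \<phi> (verts G) (verts H) \<longleftrightarrow> bij_betw \<psi> (verts G) (verts H)"
    using assms by (intro bij_betw_cong) auto
  ultimately show ?thesis
    using assms by (simp add: iso_on_def)
qed

lemma iso_on_id: "iso_on (\<lambda>v. v) G G"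
  by (auto simp: iso_on_def bij_betw_def prod.map_ident)

lemma iso_on_comp:
  assumes "iso_on \<phi> G H" "iso_on \<psi> H K"
  shows "iso_on (\<psi> \<circ> \<phi>) G K"
  using assms bij_betw_trans [of \<phi> "verts G" "verts H" \<psi> "verts K"]
  by (auto simp: iso_on_def image_image image_comp prod.map_comp o_def bij_betw_apply)

lemma iso_on_inv:
  assumes "well_formed G" "iso_on \<phi> G H"
  shows "iso_on (inv_into (verts G) \<phi>) H G"
proof -
  let ?i = "inv_into (verts G) \<phi>"
  have b: "bij_betw \<phi> (verts G) (verts H)"
    using assms by (simp add: iso_on_def)
  then have i: "?i (\<phi> v) = v" if "v \<in> verts G" for v
    using that by (simp add: bij_betw_inv_into_left)
  have "map_prod ?i ?i (map_prod \<phi> \<phi> e) = e" if "e \<in> edges G" for e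
    using that assms(1) i by (cases e) (auto simp: well_formed_def)
  then have "map_prod ?i ?i ` edges H = edges G"
    using assms(2) by (simp add: iso_on_def image_image)
  moreover have "?i ` \<phi> ` l = l" if "l \<in> lianas G" for l
    using that assms(1) b
    by (intro inv_into_image_cancel) (auto simp: well_formed_def bij_betw_def)
  then have "(\<lambda>l. ?i ` l) ` lianas H = lianas G"
    using assms(2) by (simp add: iso_on_def image_image)
  moreover have "dec H w = dec G (?i w)" if "w \<in> verts H" for w
    using assms(2) bij_betw_apply [OF bij_betw_inv_into [OF b] that]
      bij_betw_inv_into_right [OF b that] unfolding iso_on_def by simp
  ultimately show ?thesis
    using b by (simp add: iso_on_def bij_betw_inv_into)
qed

lemma iso_on_well_formed:
  assumes "well_formed G" "iso_on \<phi> G H"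
  shows "well_formed H"
proof -
  have "\<phi> ` verts G = verts H"
    using assms by (simp add: iso_on_def bij_betw_def)
  then show ?thesis
    using assms by (fastforce simp: iso_on_def well_formed_def)
qed

lemma restrict_in_isos:
  assumes "well_formed G" "iso_on \<phi> G H"
  shows "restrict \<phi> (verts G) \<in> isos G H"
  using assms iso_on_cong [OF assms(1), of \<phi> "restrict \<phi> (verts G)"] by (simp add: isos_iff)

lemma isos_nonempty_iff:
  assumes "well_formed G"
  shows "isos G H \<noteq> {} \<longleftrightarrow> (\<exists>\<phi>. iso_on \<phi> G H)"
proof
  assume "\<exists>\<phi>. iso_on \<phi> G H"
  then obtain \<phi> where "iso_on \<phi> G H" ..
  then show "isos G H \<noteq> {}"
    using restrict_in_isos [OF assms] by blast
qed (auto simp: isos_iff)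

lemma isos_trans:
  assumes "well_formed G" "well_formed H" "isos G H \<noteq> {}" "isos H K \<noteq> {}"
  shows "isos G K \<noteq> {}"
  using assms iso_on_comp by (metis isos_nonempty_iff)

lemma isos_sym:
  assumes "well_formed G" "isos G H \<noteq> {}"
  shows "isos H G \<noteq> {}"
  using assms by (metis isos_nonempty_iff iso_on_inv iso_on_well_formed)

lemma finite_isos:
  assumes "finite (verts G)" "finite (verts H)"
  shows "finite (isos G H)"
proof (rule finite_subset)
  show "isos G H \<subseteq> verts G \<rightarrow>\<^sub>E verts H"
    by (auto simp: isos_def PiE_def bij_betw_def)
qed (use assms in \<open>simp add: finite_PiE\<close>)

section \<open>Torsor property of sets of isomorphisms\<close>

lemma bij_betw_isos_left:
  assumes wf: "well_formed X" "well_formed G" and \<psi>: "iso_on \<psi> X G"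
  shows "bij_betw (\<lambda>\<alpha>. restrict (\<alpha> \<circ> \<psi>) (verts X)) (isos G K) (isos X K)"
\<comment> \<open>The inverse composes with the inverse of \<open>\<psi>\<close>. Both maps restrict
  their results, since a composite of extensional maps need not be extensional.\<close>
proof (rule bij_betw_byWitness [where f' = "\<lambda>\<beta>. restrict (\<beta> \<circ> inv_into (verts X) \<psi>) (verts G)"])
  let ?i = "inv_into (verts X) \<psi>"
  have b: "bij_betw \<psi> (verts X) (verts G)"
    using \<psi> by (simp add: iso_on_def)
  note bs = bij_betw_inv_into_left [OF b] bij_betw_inv_into_right [OF b]
    bij_betw_apply [OF b] bij_betw_apply [OF bij_betw_inv_into [OF b]]
  show "\<forall>\<alpha>\<in>isos G K. restrict (restrict (\<alpha> \<circ> \<psi>) (verts X) \<circ> ?i) (verts G) = \<alpha>"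
  proof
    fix \<alpha> assume "\<alpha> \<in> isos G K"
    then show "restrict (restrict (\<alpha> \<circ> \<psi>) (verts X) \<circ> ?i) (verts G) = \<alpha>"
      by (intro extensionalityI [where A = "verts G"]) (auto simp: isos_iff bs)
  qed
  show "\<forall>\<beta>\<in>isos X K. restrict (restrict (\<beta> \<circ> ?i) (verts G) \<circ> \<psi>) (verts X) = \<beta>"
  proof
    fix \<beta> assume "\<beta> \<in> isos X K"
    then show "restrict (restrict (\<beta> \<circ> ?i) (verts G) \<circ> \<psi>) (verts X) = \<beta>"
      by (intro extensionalityI [where A = "verts X"]) (auto simp: isos_iff bs)
  qed
  show "(\<lambda>\<alpha>. restrict (\<alpha> \<circ> \<psi>) (verts X)) ` isos G K \<subseteq> isos X K"
    using restrict_in_isos [OF wf(1) iso_on_comp [OF \<psi>]] by (auto simp: isos_iff [of _ G])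
  show "(\<lambda>\<beta>. restrict (\<beta> \<circ> ?i) (verts G)) ` isos X K \<subseteq> isos G K"
    using restrict_in_isos [OF wf(2) iso_on_comp [OF iso_on_inv [OF wf(1) \<psi>]]]
    by (auto simp: isos_iff [of _ X])
qed

lemma bij_betw_isos_right:
  assumes wf: "well_formed X" "well_formed G" and \<psi>: "iso_on \<psi> G K"
  shows "bij_betw (\<lambda>\<alpha>. restrict (\<psi> \<circ> \<alpha>) (verts X)) (isos X G) (isos X K)"
proof (rule bij_betw_byWitness [where f' = "\<lambda>\<beta>. restrict (inv_into (verts G) \<psi> \<circ> \<beta>) (verts X)"])
  let ?i = "inv_into (verts G) \<psi>"
  have b: "bij_betw \<psi> (verts G) (verts K)"
    using \<psi> by (simp add: iso_on_def)
  note bs = bij_betw_inv_into_left [OF b] bij_betw_inv_into_right [OF b]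
  show "\<forall>\<alpha>\<in>isos X G. restrict (?i \<circ> restrict (\<psi> \<circ> \<alpha>) (verts X)) (verts X) = \<alpha>"
  proof
    fix \<alpha> assume "\<alpha> \<in> isos X G"
    then show "restrict (?i \<circ> restrict (\<psi> \<circ> \<alpha>) (verts X)) (verts X) = \<alpha>"
      by (intro extensionalityI [where A = "verts X"]) (auto simp: isos_iff iso_on_def bs bij_betw_apply)
  qed
  show "\<forall>\<beta>\<in>isos X K. restrict (\<psi> \<circ> restrict (?i \<circ> \<beta>) (verts X)) (verts X) = \<beta>"
  proof
    fix \<beta> assume "\<beta> \<in> isos X K"
    then show "restrict (\<psi> \<circ> restrict (?i \<circ> \<beta>) (verts X)) (verts X) = \<beta>"
      by (intro extensionalityI [where A = "verts X"]) (auto simp: isos_iff iso_on_def bs bij_betw_apply)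
  qed
  show "(\<lambda>\<alpha>. restrict (\<psi> \<circ> \<alpha>) (verts X)) ` isos X G \<subseteq> isos X K"
    using restrict_in_isos [OF wf(1) iso_on_comp [OF _ \<psi>]] by (auto simp: isos_iff [of _ X G])
  show "(\<lambda>\<beta>. restrict (?i \<circ> \<beta>) (verts X)) ` isos X K \<subseteq> isos X G"
    using restrict_in_isos [OF wf(1) iso_on_comp [OF _ iso_on_inv [OF wf(2) \<psi>]]]
    by (auto simp: isos_iff [of _ X K])
qed

text \<open>Composing the automorphisms of \<open>X\<close> with one fixed isomorphism to
  \<open>K\<close> reaches every isomorphism exactly once.\<close>

lemma card_isos_source:
  assumes "well_formed X" "isos X K \<noteq> {}"
  shows "card (isos X K) = card (isos X X)"
proof -
  from assms obtain \<psi> where "iso_on \<psi> X K"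
    by (auto simp: isos_iff)
  from bij_betw_isos_right [OF assms(1) assms(1) this] show ?thesis
    by (metis bij_betw_same_card)
qed

text \<open>Here the automorphisms of \<open>K\<close> are composed with the fixed isomorphism
  instead. Together with \<open>card_isos_source\<close> this shows that isomorphic graphs have
  equally many automorphisms.\<close>

lemma card_isos_target:
  assumes "well_formed X" "isos X K \<noteq> {}"
  shows "card (isos X K) = card (isos K K)"
proof -
  from assms obtain \<psi> where "iso_on \<psi> X K"
    by (auto simp: isos_iff)
  from bij_betw_isos_left [OF assms(1) iso_on_well_formed [OF assms(1) this] this] show ?thesis
    by (metis bij_betw_same_card)
qed

text \<open>\<open>X\<close> may have any vertex type, in particular the sum type of an attachment.
  \<open>K\<close> lives on \<open>nat\<close> because a class consists of graphs on
  \<open>nat\<close> and the proof uses that \<open>K\<close> is a member of its own class.\<close>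

lemma iso_class_eq_iff:
  fixes K :: "(nat, 'd) dgraph"
  assumes "well_formed X" "well_formed K"
  shows "iso_class X = iso_class K \<longleftrightarrow> isos X K \<noteq> {}"
proof
  have "K \<in> iso_class K"
    unfolding iso_class_def using isos_nonempty_iff [OF assms(2), of K] iso_on_id by blast
  then show "isos X K \<noteq> {}" if "iso_class X = iso_class K"
    using that by (auto simp: iso_class_def)
  show "iso_class X = iso_class K" if "isos X K \<noteq> {}"
    unfolding iso_class_def
    using isos_trans [OF assms that]
      isos_trans [OF assms(2,1) isos_sym [OF assms(1) that]] by auto
qed

lemma rep_iso_class:
  fixes G :: "(nat, 'd) dgraph"
  assumes "well_formed G"
  shows "isos G (rep (iso_class G)) \<noteq> {}"
proof -
  have "G \<in> iso_class G"
    unfolding iso_class_def using isos_nonempty_iff [OF assms, of G] iso_on_id by blast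
  then have "rep (iso_class G) \<in> iso_class G"
    unfolding rep_def by (rule someI)
  then show ?thesis
    by (simp add: iso_class_def)
qed

section \<open>Forests and their pieces\<close>

lemma induced_simps [simp]:
  "verts (induced G S) = S" "edges (induced G S) = edges G \<inter> S \<times> S"
  "dec (induced G S) = dec G" "lianas (induced G S) = {l \<in> lianas G. l \<subseteq> S}"
  by (simp_all add: induced_def)

lemma induced_induced: "T \<subseteq> S \<Longrightarrow> induced (induced G S) T = induced G T"
  by (auto simp: induced_def)

lemma induced_verts: "well_formed G \<Longrightarrow> induced G (verts G) = G"
  by (cases G) (auto simp: induced_def well_formed_def)

lemma attach_simps [simp]:
  "verts (attach G H f) = verts G <+> verts H"
  "edges (attach G H f) = map_prod Inl Inl ` edges G \<union> map_prod Inr Inr ` edges H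
     \<union> {(Inl r, Inr v) | r v. r \<in> roots G \<and> f r = Some v}"
  "dec (attach G H f) = case_sum (dec G) (dec H)"
  "lianas (attach G H f) = (\<lambda>l. Inl ` l) ` lianas G \<union> (\<lambda>l. Inr ` l) ` lianas H"
  by (simp_all add: attach_def)

lemma empty_graph_simps [simp]:
  "verts empty_graph = {}" "edges empty_graph = {}" "lianas empty_graph = {}"
  by (simp_all add: empty_graph_def)

section \<open>Transport of roots and forests along isomorphisms\<close>

lemma roots_iso:
  assumes "edges G \<subseteq> verts G \<times> verts G" "iso_on \<phi> G H"
  shows "roots H = \<phi> ` roots G"
proof -
  have inj: "inj_on \<phi> (verts G)" and im: "verts H = \<phi> ` verts G" and e: "edges H = map_prod \<phi> \<phi> ` edges G"
    using assms(2) by (auto simp: iso_on_def bij_betw_def)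
  \<comment> \<open>An edge leaving \<open>\<phi> v\<close> comes from an edge leaving some
    \<open>a\<close> with \<open>\<phi> a = \<phi> v\<close>; as edges of \<open>G\<close> join
    vertices of \<open>G\<close>, injectivity gives \<open>a = v\<close>.\<close>
  have "(\<exists>w. (\<phi> v, w) \<in> edges H) \<longleftrightarrow> (\<exists>w. (v, w) \<in> edges G)" if "v \<in> verts G" for v
  proof
    assume "\<exists>w. (\<phi> v, w) \<in> edges H"
    then obtain a b where ab: "(a, b) \<in> edges G" "\<phi> v = \<phi> a"
      by (auto simp: e)
    then have "v = a"
      using assms(1) that inj by (auto dest: inj_onD)
    with ab show "\<exists>w. (v, w) \<in> edges G" by blast
  qed (auto simp: e)
  then show ?thesis
    unfolding roots_def im by blast
qed

lemma aromatic_forest_iso: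
  assumes "aromatic_forest G" "iso_on \<phi> G H"
  shows "aromatic_forest H"
proof -
  have inj: "inj_on \<phi> (verts G)" and im: "verts H = \<phi> ` verts G" and e: "edges H = map_prod \<phi> \<phi> ` edges G"
    using assms(2) by (auto simp: iso_on_def bij_betw_def)
  have sub: "edges G \<subseteq> verts G \<times> verts G" and sv: "single_valued (edges G)"
    using assms(1) by (auto simp: aromatic_forest_def)
  have "single_valued (edges H)"
  proof (rule single_valuedI)
    fix x y z assume "(x, y) \<in> edges H" "(x, z) \<in> edges H"
    then obtain a b a' c where "(a, b) \<in> edges G" "(a', c) \<in> edges G"
      "x = \<phi> a" "y = \<phi> b" "x = \<phi> a'" "z = \<phi> c"
      by (auto simp: e)
    moreover from this sub inj have "a = a'"
      by (auto dest: inj_onD)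
    ultimately show "y = z"
      using sv by (auto dest: single_valuedD)
  qed
  moreover have "edges H \<subseteq> verts H \<times> verts H"
    using sub by (auto simp: e im)
  ultimately show ?thesis
    using assms(1) roots_iso [OF sub assms(2)] by (auto simp: aromatic_forest_def im)
qed

text \<open>An empty liana would lie in every subset at once; matchings never contain it.\<close>

definition proper :: "('v, 'd) dgraph \<Rightarrow> bool" where
  "proper G \<longleftrightarrow> aromatic_forest G \<and> lianas G \<subseteq> Pow (verts G) \<and> {} \<notin> lianas G"

lemma proper_well_formed: "proper G \<Longrightarrow> well_formed G"
  by (auto simp: proper_def aromatic_forest_def well_formed_def)

lemma proper_finite: "proper G \<Longrightarrow> finite (verts G)"
  by (simp add: proper_def aromatic_forest_def)

lemma proper_induced: "proper G \<Longrightarrow> aromatic_forest (induced G S) \<Longrightarrow> proper (induced G S)"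
  by (auto simp: proper_def)

lemma proper_CK_subset:
  assumes "proper G" "S \<in> CK_subsets G"
  shows "proper (induced G S)" "proper (induced G (verts G - S))"
  using assms by (auto simp: CK_subsets_def intro: proper_induced)

lemma finite_CK_subsets: "proper G \<Longrightarrow> finite (CK_subsets G)"
  by (rule finite_subset [of _ "Pow (verts G)"]) (auto simp: CK_subsets_def proper_finite)

lemma finite_attach_maps:
  assumes "proper G" "proper H"
  shows "finite (attach_maps G H)"
proof -
  have "finite (roots G)"
    by (rule finite_subset [OF _ proper_finite [OF assms(1)]]) (auto simp: roots_def)
  then show ?thesis
    unfolding attach_maps_def by (intro finite_PiE) (simp_all add: proper_finite assms)
qed

lemma attach_well_formed:
  assumes "proper G" "proper H" "f \<in> attach_maps G H"
  shows "well_formed (attach G H f)"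
proof -
  have "v \<in> verts H" if "r \<in> roots G" "f r = Some v" for r v
    using assms(3) that by (force simp: attach_maps_def PiE_def Pi_def)
  moreover have "roots G \<subseteq> verts G"
    by (auto simp: roots_def)
  ultimately show ?thesis
    using assms(1,2)[THEN proper_well_formed] by (fastforce simp: well_formed_def)
qed

text \<open>No edge leads from \<open>B\<close> into \<open>A\<close>, so a root of \<open>B\<close>
  remains a root of the union; if \<open>B\<close> is empty, the union is \<open>A\<close>.\<close>

lemma aromatic_forest_induced_Un:
  assumes "single_valued (edges G)" "aromatic_forest (induced G A)" "aromatic_forest (induced G B)"
    and "edges G \<inter> B \<times> A = {}"
  shows "aromatic_forest (induced G (A \<union> B))"
proof (cases "B = {}")
  case False
  then obtain b where "b \<in> B" "\<And>w. w \<in> B \<Longrightarrow> (b, w) \<notin> edges G"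
    using assms(3) by (auto simp: aromatic_forest_def roots_def)
  with assms(4) have "b \<in> roots (induced G (A \<union> B))"
    by (auto simp: roots_def)
  with assms(1-3) show ?thesis
    by (auto simp: aromatic_forest_def intro: single_valued_subset [of _ "edges G"])
qed (use assms in simp)

section \<open>Counting attachments and cuts\<close>

text \<open>One half of the correspondence between attachments and cuts. The edges created by
  \<open>attach\<close> run from the copy of \<open>G\<close> to the copy of \<open>H\<close>, so
  neither induced piece contains one and none leaves \<open>S\<close>.\<close>

lemma attach_iso_restrict:
  assumes G: "proper G" and H: "proper H" and f: "f \<in> attach_maps G H" and \<phi>: "iso_on \<phi> (attach G H f) K"
  defines "S \<equiv> \<phi> ` Inr ` verts H"
  shows "verts K - S = \<phi> ` Inl ` verts G"
    and "iso_on (\<phi> \<circ> Inl) G (induced K (verts K - S))"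
    and "iso_on (\<phi> \<circ> Inr) H (induced K S)"
    and "edges K \<inter> S \<times> (verts K - S) = {}"
    and "\<forall>l \<in> lianas K. l \<subseteq> S \<or> l \<subseteq> verts K - S"
proof -
  let ?V = "verts G <+> verts H"
  have bij: "bij_betw \<phi> ?V (verts K)"
    and e: "edges K = map_prod \<phi> \<phi> ` edges (attach G H f)"
    and d: "\<And>v. v \<in> ?V \<Longrightarrow> case_sum (dec G) (dec H) v = dec K (\<phi> v)"
    and l: "lianas K = (\<lambda>l. \<phi> ` l) ` lianas (attach G H f)"
    using \<phi> by (simp_all add: iso_on_def)
  have inj: "inj_on \<phi> ?V" and im: "verts K = \<phi> ` ?V"
    using bij by (auto simp: bij_betw_def)
  have V: "?V = Inl ` verts G \<union> Inr ` verts H"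
    by (auto simp: Plus_def)
  have disj: "\<phi> ` Inl ` verts G \<inter> \<phi> ` Inr ` verts H = {}"
    using inj by (auto simp: inj_on_def)
  show W: "verts K - S = \<phi> ` Inl ` verts G"
    using disj unfolding im V S_def by blast
  have inl: "\<phi> (Inl v) \<notin> S" "\<phi> (Inl v) \<in> verts K - S" if "v \<in> verts G" for v
    using that disj W by (auto simp: S_def)
  have inr: "\<phi> (Inr v) \<in> S" "\<phi> (Inr v) \<notin> verts K - S" if "v \<in> verts H" for v
    using that by (auto simp: S_def)
  have eG: "edges G \<subseteq> verts G \<times> verts G" and eH: "edges H \<subseteq> verts H \<times> verts H"
    and lG: "lianas G \<subseteq> Pow (verts G)" and lH: "lianas H \<subseteq> Pow (verts H)"
    using G H by (auto simp: proper_def aromatic_forest_def)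
  have rG: "r \<in> verts G" if "r \<in> roots G" for r
    using that by (simp add: roots_def)
  have dG: "dec G v = dec K (\<phi> (Inl v))" if "v \<in> verts G" for v
    using d [of "Inl v"] that by (simp add: InlI)
  have dH: "dec H v = dec K (\<phi> (Inr v))" if "v \<in> verts H" for v
    using d [of "Inr v"] that by (simp add: InrI)
  \<comment> \<open>The edges of \<open>K\<close> are of three kinds: inside the copy of
    \<open>G\<close>, inside the copy of \<open>H\<close>, and created by attaching. The statements
    on edges below are read off from this.\<close>
  have ek: "edges K = map_prod (\<phi> \<circ> Inl) (\<phi> \<circ> Inl) ` edges G
      \<union> map_prod (\<phi> \<circ> Inr) (\<phi> \<circ> Inr) ` edges H
      \<union> {(\<phi> (Inl r), \<phi> (Inr v)) | r v. r \<in> roots G \<and> f r = Some v}"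
    unfolding e by (simp add: image_Un image_image prod.map_comp, auto)
  show "edges K \<inter> S \<times> (verts K - S) = {}"
    unfolding ek using inl inr eG eH rG by auto
  have fH: "v \<in> verts H" if "r \<in> roots G" "f r = Some v" for r v
    using f that by (force simp: attach_maps_def PiE_def Pi_def)
  have "edges K \<inter> (verts K - S) \<times> (verts K - S) = map_prod (\<phi> \<circ> Inl) (\<phi> \<circ> Inl) ` edges G"
  proof -
    have "map_prod (\<phi> \<circ> Inl) (\<phi> \<circ> Inl) ` edges G \<subseteq> (verts K - S) \<times> (verts K - S)"
      using inl(2) eG by auto
    moreover have "map_prod (\<phi> \<circ> Inr) (\<phi> \<circ> Inr) ` edges H \<inter> (verts K - S) \<times> (verts K - S) = {}"
      using inr(1) eH by auto
    moreover have "{(\<phi> (Inl r), \<phi> (Inr v)) | r v. r \<in> roots G \<and> f r = Some v}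
        \<inter> (verts K - S) \<times> (verts K - S) = {}"
      using inr(1) fH by auto
    ultimately show ?thesis
      unfolding ek by (simp add: Int_Un_distrib2 Int_absorb2)
  qed
  moreover have "{l \<in> lianas K. l \<subseteq> verts K - S} = (\<lambda>l. (\<phi> \<circ> Inl) ` l) ` lianas G"
  proof -
    have "\<phi> ` Inl ` l \<subseteq> verts K - S" if "l \<in> lianas G" for l
      using that lG inl(2) by blast
    \<comment> \<open>The image of a liana of \<open>H\<close> lies in \<open>S\<close>, so it could
      also lie in the complement only if it were empty; \<open>proper\<close> rules this
      out.\<close>
    moreover have "\<not> \<phi> ` Inr ` l \<subseteq> verts K - S" if m: "l \<in> lianas H" for l
    proof -
      have "l \<noteq> {}" "l \<subseteq> verts H"
        using m H by (auto simp: proper_def)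
      then obtain v where "v \<in> l" "v \<in> verts H"
        by blast
      then show ?thesis using inr(1) by blast
    qed
    ultimately show ?thesis
      unfolding l by (auto simp: image_comp)
  qed
  moreover have "inj_on (\<phi> \<circ> Inl) (verts G)"
    using inj by (auto simp: inj_on_def)
  ultimately show "iso_on (\<phi> \<circ> Inl) G (induced K (verts K - S))"
    using dG by (auto simp: iso_on_def bij_betw_def W image_comp)
  have "edges K \<inter> S \<times> S = map_prod (\<phi> \<circ> Inr) (\<phi> \<circ> Inr) ` edges H"
  proof -
    have "map_prod (\<phi> \<circ> Inl) (\<phi> \<circ> Inl) ` edges G \<inter> S \<times> S = {}"
      using inl(1) eG by auto
    moreover have "map_prod (\<phi> \<circ> Inr) (\<phi> \<circ> Inr) ` edges H \<subseteq> S \<times> S"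
      using inr(1) eH by auto
    moreover have "{(\<phi> (Inl r), \<phi> (Inr v)) | r v. r \<in> roots G \<and> f r = Some v} \<inter> S \<times> S = {}"
      using inl(1) rG by auto
    ultimately show ?thesis
      unfolding ek by (simp add: Int_Un_distrib2 Int_absorb2)
  qed
  moreover have "{l \<in> lianas K. l \<subseteq> S} = (\<lambda>l. (\<phi> \<circ> Inr) ` l) ` lianas H"
  proof -
    have "\<phi> ` Inr ` l \<subseteq> S" if "l \<in> lianas H" for l
      using that lH inr(1) by blast
    moreover have "\<not> \<phi> ` Inl ` l \<subseteq> S" if m: "l \<in> lianas G" for l
    proof -
      have "l \<noteq> {}" "l \<subseteq> verts G"
        using m G by (auto simp: proper_def)
      then obtain v where "v \<in> l" "v \<in> verts G"
        by blast
      then show ?thesis using inl(1) by blast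
    qed
    ultimately show ?thesis
      unfolding l by (auto simp: image_comp)
  qed
  moreover have "inj_on (\<phi> \<circ> Inr) (verts H)"
    using inj by (auto simp: inj_on_def)
  ultimately show "iso_on (\<phi> \<circ> Inr) H (induced K S)"
    using dH by (auto simp: iso_on_def bij_betw_def S_def image_comp)
  show "\<forall>l \<in> lianas K. l \<subseteq> S \<or> l \<subseteq> verts K - S"
  proof
    fix l' assume "l' \<in> lianas K"
    then consider m where "m \<in> lianas G" "l' = \<phi> ` Inl ` m" | m where "m \<in> lianas H" "l' = \<phi> ` Inr ` m"
      unfolding l by auto
    then show "l' \<subseteq> S \<or> l' \<subseteq> verts K - S"
    proof cases
      case 1 with lG inl(2) show ?thesis by blast
    next
      case 2 with lH inr(1) show ?thesis by blast
    qed
  qed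
qed

text \<open>The other half: the attaching map is recovered from the edges of \<open>K\<close> that
  cross the cut.\<close>

lemma iso_on_attach:
  assumes G: "proper G" and H: "proper H" and K: "proper K" and S: "S \<in> CK_subsets K"
    and \<phi>: "iso_on \<phi> G (induced K (verts K - S))" and \<psi>: "iso_on \<psi> H (induced K S)"
  obtains f where "f \<in> attach_maps G H" "iso_on (case_sum \<phi> \<psi>) (attach G H f) K"
proof
  \<comment> \<open>A root goes to the vertex of \<open>H\<close> over the end of its edge into
    \<open>S\<close>, and to \<open>None\<close> if there is no such edge. The edges of
    \<open>K\<close> are single-valued and \<open>\<psi>\<close> is injective, so
    \<open>SOME\<close> has only one choice.\<close>
  define f where "f = (\<lambda>r \<in> roots G. if \<exists>v \<in> verts H. (\<phi> r, \<psi> v) \<in> edges K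
      then Some (SOME v. v \<in> verts H \<and> (\<phi> r, \<psi> v) \<in> edges K) else None)"
  have sub: "S \<subseteq> verts K" and nback: "edges K \<inter> S \<times> (verts K - S) = {}"
    and uncut: "\<And>l. l \<in> lianas K \<Longrightarrow> l \<subseteq> S \<or> l \<subseteq> verts K - S"
    using S by (auto simp: CK_subsets_def)
  have sv: "single_valued (edges K)" and eK: "edges K \<subseteq> verts K \<times> verts K"
    using K by (auto simp: proper_def aromatic_forest_def)
  have b1: "inj_on \<phi> (verts G)" "\<phi> ` verts G = verts K - S"
    and b2: "inj_on \<psi> (verts H)" "\<psi> ` verts H = S"
    and e1: "map_prod \<phi> \<phi> ` edges G = edges K \<inter> (verts K - S) \<times> (verts K - S)"
    and e2: "map_prod \<psi> \<psi> ` edges H = edges K \<inter> S \<times> S"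
    and d: "\<And>v. v \<in> verts G \<Longrightarrow> dec G v = dec K (\<phi> v)" "\<And>v. v \<in> verts H \<Longrightarrow> dec H v = dec K (\<psi> v)"
    and l1: "(\<lambda>l. \<phi> ` l) ` lianas G = {l \<in> lianas K. l \<subseteq> verts K - S}"
    and l2: "(\<lambda>l. \<psi> ` l) ` lianas H = {l \<in> lianas K. l \<subseteq> S}"
    using \<phi> \<psi> by (auto simp: iso_on_def bij_betw_def)
  have f_Some: "f r = Some v \<longleftrightarrow> v \<in> verts H \<and> (\<phi> r, \<psi> v) \<in> edges K" if "r \<in> roots G" for r v
  proof -
    have uniq: "w = v" if "v \<in> verts H" "(\<phi> r, \<psi> v) \<in> edges K" "w \<in> verts H" "(\<phi> r, \<psi> w) \<in> edges K" for v w
      using that sv b2(1) by (meson inj_onD single_valuedD)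
    show ?thesis
    proof (cases "\<exists>v \<in> verts H. (\<phi> r, \<psi> v) \<in> edges K")
      case True
      then have "\<exists>v. v \<in> verts H \<and> (\<phi> r, \<psi> v) \<in> edges K" by blast
      from someI_ex [OF this] uniq True that show ?thesis
        by (auto simp: f_def)
    qed (use that in \<open>auto simp: f_def\<close>)
  qed
  show "f \<in> attach_maps G H"
    unfolding attach_maps_def
  proof (rule PiE_I)
    show "f r \<in> insert None (Some ` verts H)" if "r \<in> roots G" for r
      using f_Some [OF that] by (cases "f r") auto
  qed (simp add: f_def)
  \<comment> \<open>A vertex of \<open>G\<close> that is not a root already has its one outgoing
    edge inside the complement of \<open>S\<close>, so only roots have edges across the cut.\<close>
  have root: "x \<in> roots G" if "x \<in> verts G" "y \<in> verts H" "(\<phi> x, \<psi> y) \<in> edges K" for x y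
  proof (rule ccontr)
    assume "x \<notin> roots G"
    with \<open>x \<in> verts G\<close> obtain w where "(x, w) \<in> edges G"
      by (auto simp: roots_def)
    then have "(\<phi> x, \<phi> w) \<in> edges K \<inter> (verts K - S) \<times> (verts K - S)"
      unfolding e1 [symmetric] by force
    then show False
      using that sv b2(2) by (auto dest: single_valuedD)
  qed
  have "{(\<phi> r, \<psi> v) | r v. r \<in> roots G \<and> f r = Some v} = edges K \<inter> (verts K - S) \<times> S"
  proof
    show "{(\<phi> r, \<psi> v) | r v. r \<in> roots G \<and> f r = Some v} \<subseteq> edges K \<inter> (verts K - S) \<times> S"
      using b1(2) b2(2) f_Some by (auto simp: roots_def)
    show "edges K \<inter> (verts K - S) \<times> S \<subseteq> {(\<phi> r, \<psi> v) | r v. r \<in> roots G \<and> f r = Some v}"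
    proof clarify
      fix x y assume xy: "(x, y) \<in> edges K" "y \<in> S" "x \<in> verts K" "x \<notin> S"
      then obtain r v where "r \<in> verts G" "x = \<phi> r" "v \<in> verts H" "y = \<psi> v"
        using b1(2) b2(2) by (metis DiffI imageE)
      with xy root f_Some show "\<exists>r v. (x, y) = (\<phi> r, \<psi> v) \<and> r \<in> roots G \<and> f r = Some v"
        by blast
    qed
  qed
  moreover have "map_prod (case_sum \<phi> \<psi>) (case_sum \<phi> \<psi>) ` edges (attach G H f) =
      map_prod \<phi> \<phi> ` edges G \<union> map_prod \<psi> \<psi> ` edges H
      \<union> {(\<phi> r, \<psi> v) | r v. r \<in> roots G \<and> f r = Some v}"
  proof -
    have "map_prod (case_sum \<phi> \<psi>) (case_sum \<phi> \<psi>) ` {(Inl r, Inr v) | r v. r \<in> roots G \<and> f r = Some v} =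
        {(\<phi> r, \<psi> v) | r v. r \<in> roots G \<and> f r = Some v}"
      by force
    then show ?thesis
      by (simp add: image_Un image_image prod.map_comp comp_def)
  qed
  ultimately have "map_prod (case_sum \<phi> \<psi>) (case_sum \<phi> \<psi>) ` edges (attach G H f) =
      edges K \<inter> (verts K - S) \<times> (verts K - S) \<union> edges K \<inter> S \<times> S \<union> edges K \<inter> (verts K - S) \<times> S"
    by (simp only: e1 e2)
  \<comment> \<open>The fourth combination, an edge from \<open>S\<close> to its complement, is
    excluded by the cut condition.\<close>
  also have "\<dots> = edges K"
    using eK nback by blast
  finally have "edges K = map_prod (case_sum \<phi> \<psi>) (case_sum \<phi> \<psi>) ` edges (attach G H f)" ..
  moreover have "(\<lambda>l. case_sum \<phi> \<psi> ` l) ` lianas (attach G H f) = lianas K"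
  proof -
    have "(\<lambda>l. case_sum \<phi> \<psi> ` l) ` lianas (attach G H f) =
        (\<lambda>l. \<phi> ` l) ` lianas G \<union> (\<lambda>l. \<psi> ` l) ` lianas H"
      by (simp add: image_Un image_image)
    then show ?thesis
      unfolding l1 l2 using uncut by blast
  qed
  moreover have "bij_betw (case_sum \<phi> \<psi>) (verts (attach G H f)) (verts K)"
  proof -
    have ne: "\<phi> x \<noteq> \<psi> y" if "x \<in> verts G" "y \<in> verts H" for x y
    proof -
      have "\<phi> x \<in> verts K - S"
        unfolding b1(2) [symmetric] using that by simp
      moreover have "\<psi> y \<in> S"
        unfolding b2(2) [symmetric] using that by simp
      ultimately show ?thesis by auto
    qed
    have "inj_on (case_sum \<phi> \<psi>) (verts G <+> verts H)"
      by (rule inj_onI) (use ne ne [symmetric] inj_onD [OF b1(1)] inj_onD [OF b2(1)] in \<open>auto elim!: PlusE\<close>)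
    moreover have "case_sum \<phi> \<psi> ` (verts G <+> verts H) = \<phi> ` verts G \<union> \<psi> ` verts H"
      by (simp add: Plus_def image_Un image_image)
    then have "case_sum \<phi> \<psi> ` (verts G <+> verts H) = verts K"
      unfolding b1(2) b2(2) using sub by blast
    ultimately show ?thesis
      by (simp add: bij_betw_def)
  qed
  ultimately show "iso_on (case_sum \<phi> \<psi>) (attach G H f) K"
    using d by (auto simp: iso_on_def)
qed

text \<open>The triple no longer mentions \<open>f\<close>, so injectivity requires recovering
  \<open>f\<close> from \<open>\<phi>\<close> and the edges of \<open>K\<close>. Surjectivity is
  \<open>iso_on_attach\<close>.\<close>

lemma bij_betw_attach_cut:
  assumes G: "proper G" and H: "proper H" and K: "proper K"
  shows "bij_betw (\<lambda>(f, \<phi>). (\<phi> ` Inr ` verts H, \<phi> \<circ> Inl, \<phi> \<circ> Inr))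
    (SIGMA f:attach_maps G H. isos (attach G H f) K)
    (SIGMA S:CK_subsets K. isos G (induced K (verts K - S)) \<times> isos H (induced K S))"
    (is "bij_betw ?F ?A ?B")
  unfolding bij_betw_def
proof (intro conjI inj_onI equalityI subsetI)
  fix x y assume xy: "x \<in> ?A" "y \<in> ?A" "?F x = ?F y"
  obtain f \<phi> g \<psi> where x: "x = (f, \<phi>)" and y: "y = (g, \<psi>)"
    by fastforce
  \<comment> \<open>The composites with \<open>Inl\<close> and \<open>Inr\<close> cover the whole
    sum type and therefore determine the map.\<close>
  have "\<phi> v = \<psi> v" for v
    using xy(3) by (cases v) (auto simp: x y fun_eq_iff)
  then have \<phi>: "\<phi> = \<psi>" ..
  \<comment> \<open>The right-hand side depends on \<open>\<phi>\<close> and \<open>K\<close> but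
    not on \<open>h\<close>, so two attaching maps with the same isomorphism onto \<open>K\<close>
    coincide.\<close>
  have some: "h r = Some v \<longleftrightarrow> v \<in> verts H \<and> (\<phi> (Inl r), \<phi> (Inr v)) \<in> edges K"
    if h: "(h, \<phi>) \<in> ?A" and r: "r \<in> roots G" for h r v
  proof -
    have hm: "h \<in> attach_maps G H" and inj: "inj_on \<phi> (verts G <+> verts H)"
      and e: "edges K = map_prod \<phi> \<phi> ` edges (attach G H h)"
      using h by (auto simp: isos_def bij_betw_def)
    have wf: "edges (attach G H h) \<subseteq> (verts G <+> verts H) \<times> (verts G <+> verts H)"
      using attach_well_formed [OF G H hm] by (simp add: well_formed_def)
    have "v \<in> verts H" if "h r = Some v"
      using hm that r by (force simp: attach_maps_def PiE_def Pi_def)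
    moreover have "(\<phi> (Inl r), \<phi> (Inr v)) \<in> edges K \<longleftrightarrow> (Inl r, Inr v) \<in> edges (attach G H h)"
      if "v \<in> verts H"
    proof
      assume "(\<phi> (Inl r), \<phi> (Inr v)) \<in> edges K"
      then obtain a b where ab: "(a, b) \<in> edges (attach G H h)" "\<phi> (Inl r) = \<phi> a" "\<phi> (Inr v) = \<phi> b"
        unfolding e by (auto simp del: attach_simps)
      with wf have "a \<in> verts G <+> verts H" "b \<in> verts G <+> verts H"
        by (auto simp del: attach_simps)
      then have "Inl r = a" "Inr v = b"
        using r that inj_onD [OF inj ab(2)] inj_onD [OF inj ab(3)] by (auto simp: roots_def)
      with ab show "(Inl r, Inr v) \<in> edges (attach G H h)" by simp
    qed (auto simp: e simp del: attach_simps)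
    ultimately show ?thesis
      using r by auto
  qed
  have "f \<in> attach_maps G H" "g \<in> attach_maps G H"
    using xy by (auto simp: x y)
  then have "f = g"
    unfolding attach_maps_def
  proof (rule PiE_ext)
    fix r assume r: "r \<in> roots G"
    show "f r = g r"
      using some [of f r] some [of g r] r xy \<phi> unfolding x y by (metis option.exhaust)
  qed
  with \<phi> show "x = y" by (simp add: x y)
next
  fix y assume "y \<in> ?F ` ?A"
  then obtain f \<phi> where f: "f \<in> attach_maps G H" and \<phi>: "\<phi> \<in> isos (attach G H f) K"
    and y: "y = ?F (f, \<phi>)"
    by blast
  have iso: "iso_on \<phi> (attach G H f) K" and ext: "\<phi> \<in> extensional (verts G <+> verts H)"
    using \<phi> by (auto simp: isos_iff)
  note r = attach_iso_restrict [OF G H f iso]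
  have "\<phi> ` Inr ` verts H \<subseteq> verts K"
    using iso by (auto simp: iso_on_def bij_betw_def)
  then have "\<phi> ` Inr ` verts H \<in> CK_subsets K"
    using r(4,5) aromatic_forest_iso [OF _ r(2)] aromatic_forest_iso [OF _ r(3)] G H
    by (simp add: CK_subsets_def proper_def)
  moreover have "\<phi> \<circ> Inl \<in> extensional (verts G)" "\<phi> \<circ> Inr \<in> extensional (verts H)"
    using ext by (auto simp: extensional_def)
  ultimately show "y \<in> ?B"
    using r(2,3) by (simp add: y isos_iff)
next
  fix y assume "y \<in> ?B"
  then obtain S \<phi> \<psi> where y: "y = (S, \<phi>, \<psi>)" and S: "S \<in> CK_subsets K"
    and \<phi>: "\<phi> \<in> isos G (induced K (verts K - S))" and \<psi>: "\<psi> \<in> isos H (induced K S)"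
    by auto
  then obtain f where f: "f \<in> attach_maps G H" "iso_on (case_sum \<phi> \<psi>) (attach G H f) K"
    using iso_on_attach [OF G H K S, of \<phi> \<psi>] by (auto simp: isos_iff)
  have "case_sum \<phi> \<psi> \<in> extensional (verts G <+> verts H)"
    using \<phi> \<psi> by (auto simp: isos_iff extensional_def split: sum.split)
  then have mem: "(f, case_sum \<phi> \<psi>) \<in> ?A"
    using f by (simp add: isos_iff)
  have "\<psi> ` verts H = S"
    using \<psi> by (auto simp: isos_def bij_betw_def)
  then have "y = ?F (f, case_sum \<phi> \<psi>)"
    by (simp add: y image_image fun_eq_iff)
  with mem show "y \<in> ?F ` ?A"
    by (rule rev_image_eqI)
qed

text \<open>Each fibre over \<open>f\<close> is empty or as large as \<open>isos K K\<close>, each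
  fibre over \<open>S\<close> is empty or as large as \<open>isos G G \<times> isos H H\<close>.
  Adding up the fibre sizes thus counts the nonempty fibres.\<close>

lemma card_attach_cut:
  assumes G: "proper G" and H: "proper H" and K: "proper K"
  shows "card {f \<in> attach_maps G H. isos (attach G H f) K \<noteq> {}} * card (isos K K) =
    card {S \<in> CK_subsets K. isos G (induced K (verts K - S)) \<noteq> {} \<and> isos H (induced K S) \<noteq> {}}
      * (card (isos G G) * card (isos H H))"
proof -
  note fin = proper_finite [OF G] proper_finite [OF H] proper_finite [OF K]
  have S: "finite S" if "S \<in> CK_subsets K" for S
    using that by (auto simp: CK_subsets_def intro: finite_subset [OF _ fin(3)])
  have "card {f \<in> attach_maps G H. isos (attach G H f) K \<noteq> {}} * card (isos K K) =
      (\<Sum>f \<in> attach_maps G H. if isos (attach G H f) K \<noteq> {} then card (isos K K) else 0)"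
    using finite_attach_maps [OF G H] by (simp add: sum.If_cases Int_def)
  also have "\<dots> = (\<Sum>f \<in> attach_maps G H. card (isos (attach G H f) K))"
    by (intro sum.cong refl) (simp add: card_isos_target attach_well_formed G H)
  also have "\<dots> = card (SIGMA f:attach_maps G H. isos (attach G H f) K)"
    using finite_attach_maps [OF G H] fin by (simp add: card_SigmaI finite_isos)
  also have "\<dots> = card (SIGMA S:CK_subsets K. isos G (induced K (verts K - S)) \<times> isos H (induced K S))"
    by (rule bij_betw_same_card [OF bij_betw_attach_cut [OF assms]])
  also have "\<dots> = (\<Sum>S \<in> CK_subsets K. card (isos G (induced K (verts K - S)) \<times> isos H (induced K S)))"
    using finite_CK_subsets [OF K] fin S by (simp add: card_SigmaI finite_isos)
  also have "\<dots> = (\<Sum>S \<in> CK_subsets K.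
      if isos G (induced K (verts K - S)) \<noteq> {} \<and> isos H (induced K S) \<noteq> {}
      then card (isos G G) * card (isos H H) else 0)"
    by (intro sum.cong refl)
      (simp add: card_cartesian_product card_isos_source proper_well_formed G H)
  also have "\<dots> = card {S \<in> CK_subsets K. isos G (induced K (verts K - S)) \<noteq> {} \<and> isos H (induced K S) \<noteq> {}}
      * (card (isos G G) * card (isos H H))"
    using finite_CK_subsets [OF K] by (simp add: sum.If_cases Int_def)
  finally show ?thesis .
qed

section \<open>Coassociativity\<close>

text \<open>Both iterated coproducts count the ordered partitions of the vertices into an upper, a middle
  and a lower layer; the aromatic forest condition on a union of two layers is automatic.\<close>

definition layers :: "('v, 'd) dgraph \<Rightarrow> 'v set \<Rightarrow> 'v set \<Rightarrow> 'v set \<Rightarrow> bool" where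
  "layers K A B C \<longleftrightarrow>
     aromatic_forest (induced K A) \<and> aromatic_forest (induced K B) \<and> aromatic_forest (induced K C) \<and>
     edges K \<inter> B \<times> A = {} \<and> edges K \<inter> C \<times> A = {} \<and> edges K \<inter> C \<times> B = {} \<and>
     (\<forall>l \<in> lianas K. l \<subseteq> A \<or> l \<subseteq> B \<or> l \<subseteq> C)"

text \<open>The bottom layer \<open>S\<close> is cut off first and the rest is split. From right to
  left, the two upper layers must be joined to an aromatic forest, which is
  \<open>aromatic_forest_induced_Un\<close>.\<close>

lemma CK_subsets_upper_layers:
  assumes K: "proper K"
  shows "S \<in> CK_subsets K \<and> U \<in> CK_subsets (induced K (verts K - S)) \<longleftrightarrow>
    S \<subseteq> verts K \<and> U \<subseteq> verts K - S \<and> layers K (verts K - S - U) U S" (is "?l \<longleftrightarrow> ?r")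
proof
  assume l: ?l
  then have "m \<subseteq> verts K - S - U \<or> m \<subseteq> U \<or> m \<subseteq> S" if "m \<in> lianas K" for m
    using that by (simp add: CK_subsets_def) metis
  moreover have "edges K \<inter> U \<times> (verts K - S - U) = {}" "edges K \<inter> S \<times> (verts K - S - U) = {}" "edges K \<inter> S \<times> U = {}"
    using l by (auto simp: CK_subsets_def)
  moreover have "induced (induced K (verts K - S)) U = induced K U"
    using l by (intro induced_induced) (simp add: CK_subsets_def)
  ultimately show ?r
    using l by (simp add: CK_subsets_def layers_def induced_induced)
next
  assume r: ?r
  then have "aromatic_forest (induced K ((verts K - S - U) \<union> U))"
    using K by (intro aromatic_forest_induced_Un) (auto simp: layers_def proper_def aromatic_forest_def)
  moreover have "(verts K - S - U) \<union> U = verts K - S"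
    using r by blast
  ultimately have "aromatic_forest (induced K (verts K - S))"
    by simp
  have lianas: "m \<subseteq> verts K - S - U \<or> m \<subseteq> U \<or> m \<subseteq> S" if "m \<in> lianas K" for m
    using r that by (simp add: layers_def)
  have edges: "edges K \<inter> U \<times> (verts K - S - U) = {}"
    "edges K \<inter> S \<times> (verts K - S - U) = {}"
    "edges K \<inter> S \<times> U = {}"
    using r by (simp_all add: layers_def)
  have sub: "S \<subseteq> verts K" "U \<subseteq> verts K - S"
    using r by simp_all
  have "m \<subseteq> S \<or> m \<subseteq> verts K - S" if "m \<in> lianas K" for m
    using lianas [OF that] sub by blast
  moreover have "m \<subseteq> U \<or> m \<subseteq> verts K - S - U" if "m \<in> lianas K" "m \<subseteq> verts K - S" for m
    using lianas [OF that(1)] that(2) by blast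
  moreover have "edges K \<inter> S \<times> (verts K - S) = {}"
    using edges sub by blast
  moreover have "edges K \<inter> (verts K - S) \<times> (verts K - S) \<inter> U \<times> (verts K - S - U) = {}"
    using edges by blast
  moreover have "induced (induced K (verts K - S)) U = induced K U"
    "induced (induced K (verts K - S)) (verts K - S - U) = induced K (verts K - S - U)"
    using sub by (auto intro: induced_induced)
  ultimately show ?l
    using r \<open>aromatic_forest (induced K (verts K - S))\<close> unfolding layers_def CK_subsets_def by simp
qed

text \<open>The other order: the top layer is separated first and \<open>T\<close> is split, so now
  the two lower layers have to be joined.\<close>

lemma CK_subsets_lower_layers:
  assumes K: "proper K"
  shows "T \<in> CK_subsets K \<and> S \<in> CK_subsets (induced K T) \<longleftrightarrow>
    T \<subseteq> verts K \<and> S \<subseteq> T \<and> layers K (verts K - T) (T - S) S" (is "?l \<longleftrightarrow> ?r")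
proof
  assume l: ?l
  then have "m \<subseteq> verts K - T \<or> m \<subseteq> T - S \<or> m \<subseteq> S" if "m \<in> lianas K" for m
    using that by (simp add: CK_subsets_def) metis
  moreover have "edges K \<inter> (T - S) \<times> (verts K - T) = {}" "edges K \<inter> S \<times> (verts K - T) = {}" "edges K \<inter> S \<times> (T - S) = {}"
    using l by (auto simp: CK_subsets_def)
  moreover have "induced (induced K T) S = induced K S"
    using l by (intro induced_induced) (simp add: CK_subsets_def)
  ultimately show ?r
    using l by (simp add: CK_subsets_def layers_def induced_induced)
next
  assume r: ?r
  then have "aromatic_forest (induced K ((T - S) \<union> S))"
    using K by (intro aromatic_forest_induced_Un) (auto simp: layers_def proper_def aromatic_forest_def)
  moreover have "(T - S) \<union> S = T"
    using r by blast
  ultimately have "aromatic_forest (induced K T)"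
    by simp
  have lianas: "m \<subseteq> verts K - T \<or> m \<subseteq> T - S \<or> m \<subseteq> S" if "m \<in> lianas K" for m
    using r that by (simp add: layers_def)
  have edges: "edges K \<inter> (T - S) \<times> (verts K - T) = {}"
    "edges K \<inter> S \<times> (verts K - T) = {}"
    "edges K \<inter> S \<times> (T - S) = {}"
    using r by (simp_all add: layers_def)
  have sub: "T \<subseteq> verts K" "S \<subseteq> T"
    using r by simp_all
  have "m \<subseteq> T \<or> m \<subseteq> verts K - T" if "m \<in> lianas K" for m
    using lianas [OF that] sub by blast
  moreover have "m \<subseteq> S \<or> m \<subseteq> T - S" if "m \<in> lianas K" "m \<subseteq> T" for m
    using lianas [OF that(1)] that(2) by blast
  moreover have "edges K \<inter> T \<times> (verts K - T) = {}"
    using edges sub by blast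
  moreover have "edges K \<inter> T \<times> T \<inter> S \<times> (T - S) = {}"
    using edges by blast
  moreover have "induced (induced K T) S = induced K S"
    "induced (induced K T) (T - S) = induced K (T - S)"
    using sub by (auto intro: induced_induced)
  ultimately show ?l
    using r \<open>aromatic_forest (induced K T)\<close> unfolding layers_def CK_subsets_def by simp
qed

text \<open>Stated for a graph and not for a class, because coassociativity cuts the pieces of one
  fixed graph. Independence of the representative is \<open>CK_count_rep\<close>.\<close>

definition CK_count :: "(nat, 'd) dgraph \<Rightarrow> 'd forest \<Rightarrow> 'd forest \<Rightarrow> nat" where
  "CK_count K p q =
     card {S \<in> CK_subsets K. iso_class (induced K (verts K - S)) = p \<and> iso_class (induced K S) = q}"

text \<open>Both sides count the partitions of \<open>K\<close> into layers with classes
  \<open>p\<close>, \<open>q\<close>, \<open>r\<close> from top to bottom.\<close>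

lemma CK_count_coassoc:
  assumes K: "proper K"
  shows "(\<Sum>S \<in> {S \<in> CK_subsets K. iso_class (induced K S) = r}. CK_count (induced K (verts K - S)) p q) =
    (\<Sum>T \<in> {T \<in> CK_subsets K. iso_class (induced K (verts K - T)) = p}. CK_count (induced K T) q r)"
proof -
  let ?c = "\<lambda>S. iso_class (induced K S)"
  define L where "L S = {U \<in> CK_subsets (induced K (verts K - S)). ?c (verts K - S - U) = p \<and> ?c U = q}" for S
  define R where "R T = {S \<in> CK_subsets (induced K T). ?c (T - S) = q \<and> ?c S = r}" for T
  let ?A = "SIGMA S:{S \<in> CK_subsets K. ?c S = r}. L S"
  let ?B = "SIGMA T:{T \<in> CK_subsets K. ?c (verts K - T) = p}. R T"
  have L: "CK_count (induced K (verts K - S)) p q = card (L S)" for S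
    unfolding CK_count_def L_def
    by (intro arg_cong [where f = card] Collect_cong) (auto simp: CK_subsets_def induced_induced Diff_subset)
  have R: "CK_count (induced K T) q r = card (R T)" for T
    unfolding CK_count_def R_def
    by (intro arg_cong [where f = card] Collect_cong) (auto simp: CK_subsets_def induced_induced Diff_subset)
  have fin: "finite (L S)" "finite (R S)" if "S \<in> CK_subsets K" for S
    using finite_CK_subsets [OF proper_CK_subset(1) [OF K that]]
      finite_CK_subsets [OF proper_CK_subset(2) [OF K that]] by (auto simp: L_def R_def)
  have A: "(S, U) \<in> ?A \<longleftrightarrow> S \<subseteq> verts K \<and> U \<subseteq> verts K - S \<and> layers K (verts K - S - U) U S \<and>
      ?c (verts K - S - U) = p \<and> ?c U = q \<and> ?c S = r" for S U
    using CK_subsets_upper_layers [OF K, of S U] by (auto simp: L_def)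
  have B: "(T, S) \<in> ?B \<longleftrightarrow> T \<subseteq> verts K \<and> S \<subseteq> T \<and> layers K (verts K - T) (T - S) S \<and>
      ?c (verts K - T) = p \<and> ?c (T - S) = q \<and> ?c S = r" for S T
    using CK_subsets_lower_layers [OF K, of T S] by (auto simp: R_def)
  \<comment> \<open>\<open>(S, U)\<close> records the bottom and the middle layer,
    \<open>(T, S)\<close> the union of these two and the bottom layer.\<close>
  have "bij_betw (\<lambda>(S, U). (S \<union> U, S)) ?A ?B"
  proof (rule bij_betw_byWitness [where f' = "\<lambda>(T, S). (S, T - S)"])
    show "\<forall>x\<in>?A. (\<lambda>(T, S). (S, T - S)) ((\<lambda>(S, U). (S \<union> U, S)) x) = x"
    proof
      fix x assume "x \<in> ?A"
      moreover obtain S U where x: "x = (S, U)"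
        by fastforce
      ultimately have "U \<subseteq> verts K - S"
        using A by simp
      then show "(\<lambda>(T, S). (S, T - S)) ((\<lambda>(S, U). (S \<union> U, S)) x) = x"
        unfolding x by auto
    qed
    show "\<forall>x\<in>?B. (\<lambda>(S, U). (S \<union> U, S)) ((\<lambda>(T, S). (S, T - S)) x) = x"
    proof
      fix x assume "x \<in> ?B"
      moreover obtain T S where x: "x = (T, S)"
        by fastforce
      ultimately have "S \<subseteq> T"
        using B by simp
      then show "(\<lambda>(S, U). (S \<union> U, S)) ((\<lambda>(T, S). (S, T - S)) x) = x"
        unfolding x by auto
    qed
    show "(\<lambda>(S, U). (S \<union> U, S)) ` ?A \<subseteq> ?B"
    proof (rule image_subsetI)
      fix x assume "x \<in> ?A"
      moreover obtain S U where x: "x = (S, U)"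
        by fastforce
      ultimately have SU: "(S, U) \<in> ?A" by simp
      then have "verts K - S - U = verts K - (S \<union> U)" "S \<union> U - S = U" "S \<union> U \<subseteq> verts K"
        unfolding A by auto
      with SU have "(S \<union> U, S) \<in> ?B"
        unfolding A B by simp
      then show "(\<lambda>(S, U). (S \<union> U, S)) x \<in> ?B"
        by (simp only: x prod.case)
    qed
    show "(\<lambda>(T, S). (S, T - S)) ` ?B \<subseteq> ?A"
    proof (rule image_subsetI)
      fix x assume "x \<in> ?B"
      moreover obtain T S where x: "x = (T, S)"
        by fastforce
      ultimately have TS: "(T, S) \<in> ?B" by simp
      then have "verts K - S - (T - S) = verts K - T" "S \<subseteq> verts K" "T - S \<subseteq> verts K - S"
        unfolding B by auto
      with TS have "(S, T - S) \<in> ?A"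
        unfolding A B by simp
      then show "(\<lambda>(T, S). (S, T - S)) x \<in> ?A"
        by (simp only: x prod.case)
    qed
  qed
  then have "card ?A = card ?B"
    by (rule bij_betw_same_card)
  then show ?thesis
    unfolding L R using finite_CK_subsets [OF K] fin by (simp add: card_SigmaI)
qed

text \<open>The elements of \<open>C\<close>, later a set of cuts, are sorted by the value of
  \<open>g\<close>, later the class of a piece. A value outside the support contributes zero on the
  right, so the left sum may stop at the keys of \<open>x\<close>.\<close>

lemma sum_lookup_card_fibres:
  assumes "finite C"
  shows "(\<Sum>q\<in>Poly_Mapping.keys x. Poly_Mapping.lookup x q * real (card {S \<in> C. g S = q})) =
    (\<Sum>S\<in>C. Poly_Mapping.lookup x (g S))"
proof -
  have "real (card {S \<in> C. g S = q}) = (\<Sum>S\<in>C. if g S = q then 1 else 0)" for q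
    using assms by (simp add: sum.If_cases Int_def)
  then have "(\<Sum>q\<in>Poly_Mapping.keys x. Poly_Mapping.lookup x q * real (card {S \<in> C. g S = q})) =
      (\<Sum>q\<in>Poly_Mapping.keys x. \<Sum>S\<in>C. if g S = q then Poly_Mapping.lookup x q else 0)"
    by (simp add: sum_distrib_left if_distrib cong: if_cong)
  also have "\<dots> = (\<Sum>S\<in>C. \<Sum>q\<in>Poly_Mapping.keys x. if g S = q then Poly_Mapping.lookup x q else 0)"
    by (rule sum.swap)
  also have "\<dots> = (\<Sum>S\<in>C. Poly_Mapping.lookup x (g S))"
    by (intro sum.cong refl) (simp add: in_keys_iff)
  finally show ?thesis .
qed

lemma lookup_CK_coproduct:
  assumes "proper (rep p)"
  shows "Poly_Mapping.lookup (CK_coproduct p) (a, b) = CK_count (rep p) a b"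
proof -
  let ?K = "rep p"
  have "Poly_Mapping.lookup (CK_coproduct p) (a, b) = (\<Sum>S\<in>CK_subsets ?K.
      if iso_class (induced ?K (verts ?K - S)) = a \<and> iso_class (induced ?K S) = b then 1 else 0)"
    unfolding CK_coproduct_def lookup_sum by (intro sum.cong) (auto simp: lookup_single when_def)
  then show ?thesis
    using finite_CK_subsets [OF assms] by (simp add: CK_count_def sum.If_cases Int_def)
qed

section \<open>The isomorphism\<close>

locale forest_class =
  fixes P :: "(nat, 'd) dgraph \<Rightarrow> bool"
  assumes proper: "P G \<Longrightarrow> proper G"
    and iso_invariant: "P G \<Longrightarrow> iso_on \<phi> G H \<Longrightarrow> P H"
    and empty_graph: "P empty_graph"
    and pieces: "P G \<Longrightarrow> S \<in> CK_subsets G \<Longrightarrow> P (induced G S) \<and> P (induced G (verts G - S))"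
begin

definition classes :: "'d forest set" where
  "classes = {iso_class G | G. P G}"

lemma iso_class_in_classes: "P G \<Longrightarrow> iso_class G \<in> classes"
  by (auto simp: classes_def)

lemma rep_iso: "P G \<Longrightarrow> isos G (rep (iso_class G)) \<noteq> {}"
  by (rule rep_iso_class [OF proper_well_formed [OF proper]])

lemma rep_classes: "p \<in> classes \<Longrightarrow> P (rep p)"
  using rep_iso iso_invariant by (fastforce simp: classes_def isos_iff)

lemma iso_class_rep: "p \<in> classes \<Longrightarrow> iso_class (rep p) = p"
  using rep_iso rep_classes iso_class_eq_iff proper proper_well_formed
  by (smt (verit) classes_def mem_Collect_eq)

text \<open>The identity is an automorphism, and a finite graph has finitely many. Positivity
  permits cancelling symmetries and inverting \<open>A_sigma\<close>.\<close>

lemma symmetry_pos: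
  assumes "p \<in> classes"
  shows "symmetry p > 0"
proof -
  note pr = proper [OF rep_classes [OF assms]]
  have "isos (rep p) (rep p) \<noteq> {}"
    using isos_nonempty_iff [OF proper_well_formed [OF pr]] iso_on_id by blast
  then show ?thesis
    unfolding symmetry_def using finite_isos [OF pr [THEN proper_finite] pr [THEN proper_finite]]
    by (simp add: card_gt_0_iff)
qed

section \<open>Structure constants of the two products\<close>

definition GL_count :: "'d forest \<Rightarrow> 'd forest \<Rightarrow> 'd forest \<Rightarrow> nat" where
  "GL_count p q k = card {f \<in> attach_maps (rep p) (rep q). iso_class (attach (rep p) (rep q) f) = k}"

lemma CK_GL_count:
  assumes p: "p \<in> classes" and q: "q \<in> classes" and K: "P K"
  shows "symmetry (iso_class K) * GL_count p q (iso_class K) = symmetry p * symmetry q * CK_count K p q"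
proof -
  note pp = proper [OF rep_classes [OF p]] and pq = proper [OF rep_classes [OF q]] and pK = proper [OF K]
  have wf: "well_formed K"
    using proper_well_formed [OF pK] .
  have "iso_class (attach (rep p) (rep q) f) = iso_class K \<longleftrightarrow> isos (attach (rep p) (rep q) f) K \<noteq> {}"
    if "f \<in> attach_maps (rep p) (rep q)" for f
    using iso_class_eq_iff [OF attach_well_formed [OF pp pq that] wf] .
  then have 1: "{f \<in> attach_maps (rep p) (rep q). iso_class (attach (rep p) (rep q) f) = iso_class K} =
      {f \<in> attach_maps (rep p) (rep q). isos (attach (rep p) (rep q) f) K \<noteq> {}}"
    by blast
  have eq: "iso_class X = r \<longleftrightarrow> isos (rep r) X \<noteq> {}"
    if "well_formed X" "r \<in> classes" for X :: "(nat, 'd) dgraph" and r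
    using iso_class_eq_iff [OF proper_well_formed [OF proper [OF rep_classes [OF that(2)]]] that(1)]
      iso_class_rep [OF that(2)] by auto
  have 2: "CK_count K p q = card {S \<in> CK_subsets K.
      isos (rep p) (induced K (verts K - S)) \<noteq> {} \<and> isos (rep q) (induced K S) \<noteq> {}}"
    unfolding CK_count_def
    using eq [OF proper_well_formed [OF proper_CK_subset(1) [OF pK]] q]
      eq [OF proper_well_formed [OF proper_CK_subset(2) [OF pK]] p]
    by (intro arg_cong [where f = card]) auto
  \<comment> \<open>\<open>K\<close> is isomorphic to the representative of its class, so both have
    the same number of automorphisms.\<close>
  have "card (isos K K) = symmetry (iso_class K)"
    using card_isos_source [OF wf rep_iso [OF K]] card_isos_target [OF wf rep_iso [OF K]]
    by (simp add: symmetry_def)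
  then show ?thesis
    using card_attach_cut [OF pp pq pK] unfolding GL_count_def 1 2
    by (simp add: symmetry_def mult.commute)
qed

text \<open>For \<open>K\<close> and for \<open>rep (iso_class K)\<close> the left-hand side of
  \<open>CK_GL_count\<close> is the same; cancelling the positive factors \<open>symmetry p\<close>
  and \<open>symmetry q\<close> gives the claim without transporting cuts along an
  isomorphism.\<close>

lemma CK_count_rep:
  assumes "p \<in> classes" "q \<in> classes" "P K"
  shows "CK_count (rep (iso_class K)) p q = CK_count K p q"
proof -
  have k: "iso_class K \<in> classes"
    using assms(3) by (rule iso_class_in_classes)
  show ?thesis
    using CK_GL_count [OF assms] CK_GL_count [OF assms(1,2) rep_classes [OF k]]
      symmetry_pos [OF assms(1)] symmetry_pos [OF assms(2)] by (simp add: iso_class_rep k)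
qed

lemma lookup_GL_basis:
  assumes "p \<in> classes" "q \<in> classes"
  shows "Poly_Mapping.lookup (GL_basis classes p q) k = (if k \<in> classes then GL_count p q k else 0)"
proof -
  have "Poly_Mapping.lookup (GL_basis classes p q) k = (\<Sum>f\<in>attach_maps (rep p) (rep q).
      if iso_class (attach (rep p) (rep q) f) = k then (if k \<in> classes then 1 else 0) else 0)"
    unfolding GL_basis_def lookup_sum by (intro sum.cong) (auto simp: lookup_single when_def)
  then show ?thesis
    using finite_attach_maps [OF proper [OF rep_classes [OF assms(1)]] proper [OF rep_classes [OF assms(2)]]]
    by (simp add: GL_count_def sum.If_cases Int_def)
qed

text \<open>By \<open>CK_GL_count\<close>, a forest that can be cut into \<open>p\<close> and
  \<open>q\<close> also arises by attaching \<open>p\<close> to \<open>q\<close>, and the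
  Grossman--Larson product has finite support.\<close>

lemma finite_CK_support:
  assumes "p \<in> classes" "q \<in> classes"
  shows "finite {k \<in> classes. CK_count (rep k) p q \<noteq> 0}"
proof (rule finite_subset [OF _ finite_keys [of "GL_basis classes p q"]], rule subsetI)
  fix k assume "k \<in> {k \<in> classes. CK_count (rep k) p q \<noteq> 0}"
  then have k: "k \<in> classes" "CK_count (rep k) p q \<noteq> 0"
    by auto
  then show "k \<in> Poly_Mapping.keys (GL_basis classes p q)"
    using CK_GL_count [OF assms rep_classes [OF k(1)]] symmetry_pos assms
    by (simp add: in_keys_iff lookup_GL_basis iso_class_rep) (metis mult_is_0 not_gr0)
qed

lemma lookup_CK_dual_basis:
  assumes "p \<in> classes" "q \<in> classes"
  shows "Poly_Mapping.lookup (CK_dual_basis classes p q) k = (if k \<in> classes then CK_count (rep k) p q else 0)"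
proof -
  have *: "(\<lambda>k. if k \<in> classes then Poly_Mapping.lookup (CK_coproduct k) (p, q) else 0) =
      (\<lambda>k. if k \<in> classes then real (CK_count (rep k) p q) else 0)"
    by (auto simp: fun_eq_iff lookup_CK_coproduct proper rep_classes)
  \<comment> \<open>Finite support is what allows \<open>lookup\<close> to undo the
    \<open>Abs_poly_mapping\<close> in \<open>CK_dual_basis\<close>.\<close>
  have "finite {k. (if k \<in> classes then real (CK_count (rep k) p q) else 0) \<noteq> 0}"
    by (rule finite_subset [OF _ finite_CK_support [OF assms]]) (auto split: if_splits)
  then show ?thesis
    unfolding CK_dual_basis_def * by simp
qed

text \<open>Coefficientwise this is \<open>CK_GL_count\<close> at \<open>rep k\<close>. The scalar
  is what bilinearity extracts from the product of \<open>A_sigma (basis p)\<close> and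
  \<open>A_sigma (basis q)\<close>.\<close>

lemma A_sigma_GL_basis:
  assumes "p \<in> classes" "q \<in> classes"
  shows "A_sigma (GL_basis classes p q) = real (symmetry p * symmetry q) *\<^sub>R CK_dual_basis classes p q"
proof (rule poly_mapping_eqI)
  fix k
  show "Poly_Mapping.lookup (A_sigma (GL_basis classes p q)) k =
      Poly_Mapping.lookup (real (symmetry p * symmetry q) *\<^sub>R CK_dual_basis classes p q) k"
  proof (cases "k \<in> classes")
    case True
    have "real (symmetry k * GL_count p q k) = real (symmetry p * symmetry q * CK_count (rep k) p q)"
      using CK_GL_count [OF assms rep_classes [OF True]] by (simp only: iso_class_rep [OF True])
    with True show ?thesis
      by (simp add: lookup_A_sigma lookup_GL_basis lookup_CK_dual_basis assms)
  qed (simp add: lookup_A_sigma lookup_GL_basis lookup_CK_dual_basis assms)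
qed

section \<open>\<open>A_sigma\<close> as a multiplicative linear bijection\<close>

lemma linear_A_sigma: "linear A_sigma"
  unfolding A_sigma_def by (rule linear_linear_extend)

lemma A_sigma_basis: "A_sigma (basis p) = real (symmetry p) *\<^sub>R basis p"
  by (simp add: A_sigma_def)

lemma A_sigma_GL_product:
  assumes "x \<in> span_forests classes" "y \<in> span_forests classes"
  shows "A_sigma (GL_product classes x y) = CK_dual_product classes (A_sigma x) (A_sigma y)"
proof -
  note lin = linear_compose [OF linear_bilinear_extend_left linear_A_sigma, unfolded comp_def]
    linear_compose [OF linear_bilinear_extend_right linear_A_sigma, unfolded comp_def]
    linear_compose [OF linear_A_sigma linear_bilinear_extend_left, unfolded comp_def]
    linear_compose [OF linear_A_sigma linear_bilinear_extend_right, unfolded comp_def]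
  have "A_sigma (GL_product classes (basis p) y) = CK_dual_product classes (A_sigma (basis p)) (A_sigma y)"
    if "p \<in> classes" for p
    unfolding GL_product_def CK_dual_product_def
    by (rule linear_eq_on_span_forests [OF _ _ assms(2)])
      (use that in \<open>simp_all add: lin linear_compose_scale_right A_sigma_GL_basis A_sigma_basis
        bilinear_extend_scale_left bilinear_extend_scale_right\<close>)
  then show ?thesis
    unfolding GL_product_def CK_dual_product_def
    by (intro linear_eq_on_span_forests [OF _ _ assms(1), of "\<lambda>x. A_sigma (bilinear_extend _ x y)"
          "\<lambda>x. bilinear_extend _ (A_sigma x) (A_sigma y)"]) (simp_all add: lin)
qed

lemma A_sigma_in_span:
  "x \<in> span_forests classes \<Longrightarrow> A_sigma x \<in> span_forests classes"
  by (auto simp: span_forests_def in_keys_iff lookup_A_sigma subset_iff)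

lemma bij_betw_A_sigma: "bij_betw A_sigma (span_forests classes) (span_forests classes)"
\<comment> \<open>The inverse divides each coefficient by the symmetry, which is positive on
  \<open>classes\<close>.\<close>
proof (rule bij_betw_byWitness [where f' = "linear_extend (\<lambda>p. inverse (real (symmetry p)) *\<^sub>R basis p)"])
  let ?i = "linear_extend (\<lambda>p. inverse (real (symmetry p)) *\<^sub>R basis p) :: ('d forest \<Rightarrow>\<^sub>0 real) \<Rightarrow> _"
  have sc: "f (c *\<^sub>R z) = c *\<^sub>R f z" if "linear f" for f :: "('d forest \<Rightarrow>\<^sub>0 real) \<Rightarrow> ('d forest \<Rightarrow>\<^sub>0 real)" and c z
    using linear_scale [OF that] .
  have "?i (A_sigma x) = x" if "x \<in> span_forests classes" for x
    by (rule linear_eq_on_span_forests [OF _ linear_id that, of "\<lambda>x. ?i (A_sigma x)", unfolded id_def])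
      (use symmetry_pos in \<open>auto simp: linear_compose [OF linear_A_sigma linear_linear_extend, unfolded comp_def]
        A_sigma_basis sc [OF linear_linear_extend]\<close>)
  then show "\<forall>x\<in>span_forests classes. ?i (A_sigma x) = x" ..
  have "A_sigma (?i x) = x" if "x \<in> span_forests classes" for x
    by (rule linear_eq_on_span_forests [OF _ linear_id that, of "\<lambda>x. A_sigma (?i x)", unfolded id_def])
      (use symmetry_pos in \<open>auto simp: linear_compose [OF linear_linear_extend linear_A_sigma, unfolded comp_def]
        A_sigma_basis sc [OF linear_A_sigma]\<close>)
  then show "\<forall>x\<in>span_forests classes. A_sigma (?i x) = x" ..
  show "A_sigma ` span_forests classes \<subseteq> span_forests classes"
    using A_sigma_in_span by blast
  show "?i ` span_forests classes \<subseteq> span_forests classes"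
    by (intro image_subsetI linear_extend_in_subspace subspace_span_forests)
      (auto simp: span_forests_def in_keys_iff lookup_single when_def split: if_splits)
qed

text \<open>Both coefficients at \<open>k\<close> are computed on the single graph
  \<open>rep k\<close>, where \<open>CK_count_coassoc\<close> applies.\<close>

lemma CK_dual_assoc:
  assumes p: "p \<in> classes" and q: "q \<in> classes" and r: "r \<in> classes"
  defines "m \<equiv> bilinear_extend (CK_dual_basis classes)"
  shows "m (CK_dual_basis classes p q) (basis r) = m (basis p) (CK_dual_basis classes q r)"
proof (rule poly_mapping_eqI)
  fix k
  let ?d = "CK_dual_basis classes"
  have keys: "a \<in> classes" if "a \<in> Poly_Mapping.keys (?d u v)" "u \<in> classes" "v \<in> classes" for a u v
    using that by (auto simp: in_keys_iff lookup_CK_dual_basis split: if_splits)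
  show "Poly_Mapping.lookup (m (?d p q) (basis r)) k = Poly_Mapping.lookup (m (basis p) (?d q r)) k"
  proof (cases "k \<in> classes")
    case False
    then show ?thesis
      unfolding m_def lookup_bilinear_extend_basis_left lookup_bilinear_extend_basis_right
      by (simp add: lookup_CK_dual_basis keys p q r)
  next
    case True
    define K where "K = rep k"
    have PK: "P K"
      unfolding K_def using True by (rule rep_classes)
    note fin = finite_CK_subsets [OF proper [OF PK]]
    let ?V = "verts K" and ?c = "\<lambda>S. iso_class (induced K S)"
    \<comment> \<open>A piece of \<open>K\<close> need not be the chosen representative of its
      class; \<open>CK_count_rep\<close> allows the coefficient to be counted on the piece
      itself.\<close>
    have lk: "Poly_Mapping.lookup (?d u v) (iso_class G) = CK_count G u v"
      if "P G" "u \<in> classes" "v \<in> classes" for u v G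
      using that by (simp add: lookup_CK_dual_basis iso_class_in_classes CK_count_rep)
    let ?L = "{S \<in> CK_subsets K. ?c S = r}"
    \<comment> \<open>The sum over the intermediate class \<open>a\<close> becomes a sum over the
      cuts of \<open>K\<close> with lower piece in \<open>r\<close>; each contributes the number of
      cuts of its upper piece into \<open>p\<close> and \<open>q\<close>.\<close>
    have "Poly_Mapping.lookup (m (?d p q) (basis r)) k =
        (\<Sum>a\<in>Poly_Mapping.keys (?d p q). Poly_Mapping.lookup (?d p q) a * real (card {S \<in> ?L. ?c (?V - S) = a}))"
      unfolding m_def lookup_bilinear_extend_basis_right
      by (intro sum.cong refl)
        (simp add: lookup_CK_dual_basis keys p q r True CK_count_def K_def conj_commute conj_left_commute)
    also have "\<dots> = (\<Sum>S\<in>?L. Poly_Mapping.lookup (?d p q) (?c (?V - S)))"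
      using fin by (intro sum_lookup_card_fibres) simp
    also have "\<dots> = real (\<Sum>S\<in>?L. CK_count (induced K (?V - S)) p q)"
      using pieces [OF PK] lk p q by (auto intro!: sum.cong)
    finally have left: "Poly_Mapping.lookup (m (?d p q) (basis r)) k = \<dots>" .
    let ?R = "{T \<in> CK_subsets K. ?c (?V - T) = p}"
    have "Poly_Mapping.lookup (m (basis p) (?d q r)) k =
        (\<Sum>a\<in>Poly_Mapping.keys (?d q r). Poly_Mapping.lookup (?d q r) a * real (card {T \<in> ?R. ?c T = a}))"
      unfolding m_def lookup_bilinear_extend_basis_left
      by (intro sum.cong refl)
        (simp add: lookup_CK_dual_basis keys p q r True CK_count_def K_def conj_commute conj_left_commute)
    also have "\<dots> = (\<Sum>T\<in>?R. Poly_Mapping.lookup (?d q r) (?c T))"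
      using fin by (intro sum_lookup_card_fibres) simp
    also have "\<dots> = real (\<Sum>T\<in>?R. CK_count (induced K T) q r)"
      using pieces [OF PK] lk q r by (auto intro!: sum.cong)
    finally have right: "Poly_Mapping.lookup (m (basis p) (?d q r)) k = \<dots>" .
    show ?thesis
      unfolding left right using CK_count_coassoc [OF proper [OF PK], of p q r] by (simp only:)
  qed
qed

section \<open>The empty forest as unit\<close>

abbreviation unit_class :: "'d forest" where
  "unit_class \<equiv> iso_class (empty_graph :: (nat, 'd) dgraph)"

lemma unit_class_in_classes: "unit_class \<in> classes"
  using empty_graph by (rule iso_class_in_classes)

lemma iso_class_eq_unit_class:
  fixes G :: "(nat, 'd) dgraph"
  assumes "proper G"
  shows "iso_class G = unit_class \<longleftrightarrow> verts G = {}"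
proof -
  have "iso_class G = unit_class \<longleftrightarrow> (\<exists>\<phi>. iso_on \<phi> G (empty_graph :: (nat, 'd) dgraph))"
    using iso_class_eq_iff [OF proper_well_formed [OF assms] proper_well_formed [OF proper [OF empty_graph]]]
      isos_nonempty_iff [OF proper_well_formed [OF assms], of "empty_graph :: (nat, 'd) dgraph"] by simp
  also have "\<dots> \<longleftrightarrow> verts G = {}"
    using assms by (auto simp: iso_on_def bij_betw_def proper_def aromatic_forest_def)
  finally show ?thesis .
qed

lemma symmetry_unit_class: "symmetry unit_class = 1"
proof -
  have pr: "proper (rep unit_class)"
    using unit_class_in_classes by (intro proper rep_classes)
  then have "verts (rep unit_class) = {}"
    using iso_class_eq_unit_class [OF pr] iso_class_rep [OF unit_class_in_classes] by simp
  moreover from this pr have "edges (rep unit_class) = {}" "lianas (rep unit_class) = {}"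
    by (auto simp: proper_def aromatic_forest_def)
  \<comment> \<open>On the empty vertex set the only extensional map is constantly
    \<open>undefined\<close>.\<close>
  ultimately have "isos (rep unit_class) (rep unit_class) = {\<lambda>_. undefined}"
    by (auto simp: isos_def bij_betw_def)
  then show ?thesis
    by (simp add: symmetry_def)
qed

lemma A_sigma_unit: "A_sigma empty_forest = (empty_forest :: 'd forest \<Rightarrow>\<^sub>0 real)"
  by (simp add: empty_forest_def A_sigma_basis symmetry_unit_class)

text \<open>An empty piece forces a trivial cut, \<open>S = {}\<close> in the first case and
  \<open>S = verts K\<close> in the second; the other piece is then \<open>K\<close> itself.\<close>

lemma CK_count_unit:
  assumes K: "P K"
  shows "CK_count K p unit_class = (if iso_class K = p then 1 else 0)"
    and "CK_count K unit_class p = (if iso_class K = p then 1 else 0)"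
proof -
  note pK = proper [OF K]
  have iK: "induced K (verts K) = K"
    using induced_verts [OF proper_well_formed [OF pK]] .
  have emp: "aromatic_forest (induced K {})"
    by (simp add: aromatic_forest_def)
  have cK: "{} \<in> CK_subsets K" "verts K \<in> CK_subsets K"
    using pK emp iK by (auto simp: CK_subsets_def proper_def)
  have "iso_class (induced K S) = unit_class \<longleftrightarrow> S = {}" if "S \<in> CK_subsets K" for S
    using iso_class_eq_unit_class [OF proper_CK_subset(1) [OF pK that]] by simp
  then have "{S \<in> CK_subsets K. iso_class (induced K (verts K - S)) = p \<and> iso_class (induced K S) = unit_class} =
      (if iso_class K = p then {{}} else {})"
    using cK by (auto simp: iK)
  then show "CK_count K p unit_class = (if iso_class K = p then 1 else 0)"
    by (simp add: CK_count_def)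
  have "iso_class (induced K (verts K - S)) = unit_class \<longleftrightarrow> S = verts K" if "S \<in> CK_subsets K" for S
    using iso_class_eq_unit_class [OF proper_CK_subset(2) [OF pK that]] that
    by (auto simp: CK_subsets_def)
  then have "{S \<in> CK_subsets K. iso_class (induced K (verts K - S)) = unit_class \<and> iso_class (induced K S) = p} =
      (if iso_class K = p then {verts K} else {})"
    using cK by (auto simp: iK)
  then show "CK_count K unit_class p = (if iso_class K = p then 1 else 0)"
    by (simp add: CK_count_def)
qed

lemma CK_dual_basis_unit:
  assumes "p \<in> classes"
  shows "CK_dual_basis classes p unit_class = basis p" "CK_dual_basis classes unit_class p = basis p"
  using assms
  by (auto intro!: poly_mapping_eqI simp: lookup_CK_dual_basis unit_class_in_classes CK_count_unit
      rep_classes iso_class_rep lookup_single when_def)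

section \<open>The two algebra structures and the isomorphism between them\<close>

lemma CK_dual_algebra:
  "algebra_on (span_forests classes) (CK_dual_product classes) empty_forest"
proof
  note lin_l = linear_bilinear_extend_left [of "CK_dual_basis classes"]
    and lin_r = linear_bilinear_extend_right [of "CK_dual_basis classes"]
  show "subspace (span_forests classes)"
    by (rule subspace_span_forests)
  show "empty_forest \<in> span_forests classes"
    by (simp add: empty_forest_def span_forests_def unit_class_in_classes)
  fix x y z :: "'d forest \<Rightarrow>\<^sub>0 real" and c :: real
  assume x: "x \<in> span_forests classes"
  show "CK_dual_product classes empty_forest x = x"
    using linear_eq_on_span_forests [OF lin_r linear_id x, of "basis unit_class"]
    by (simp add: CK_dual_product_def empty_forest_def CK_dual_basis_unit)
  show "CK_dual_product classes x empty_forest = x"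
    using linear_eq_on_span_forests [OF lin_l linear_id x, of "basis unit_class"]
    by (simp add: CK_dual_product_def empty_forest_def CK_dual_basis_unit)
  assume y: "y \<in> span_forests classes"
  show "CK_dual_product classes x y \<in> span_forests classes"
    unfolding CK_dual_product_def
  proof (rule bilinear_extend_in_subspace [OF subspace_span_forests x y])
    show "CK_dual_basis classes p q \<in> span_forests classes" if "p \<in> classes" "q \<in> classes" for p q
      using that by (auto simp: span_forests_def in_keys_iff lookup_CK_dual_basis split: if_splits)
  qed
  show "CK_dual_product classes (c *\<^sub>R x) y = c *\<^sub>R CK_dual_product classes x y"
    and "CK_dual_product classes x (c *\<^sub>R y) = c *\<^sub>R CK_dual_product classes x y"
    by (simp_all add: CK_dual_product_def bilinear_extend_scale_left bilinear_extend_scale_right)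
  assume z: "z \<in> span_forests classes"
  show "CK_dual_product classes (x + y) z = CK_dual_product classes x z + CK_dual_product classes y z"
    and "CK_dual_product classes x (y + z) = CK_dual_product classes x y + CK_dual_product classes x z"
    unfolding CK_dual_product_def using linear_add [OF lin_l] linear_add [OF lin_r] by simp_all
  show "CK_dual_product classes (CK_dual_product classes x y) z = CK_dual_product classes x (CK_dual_product classes y z)"
    unfolding CK_dual_product_def
    by (rule bilinear_extend_assoc [OF _ x y z]) (rule CK_dual_assoc)
qed

lemma GL_algebra:
  "algebra_on (span_forests classes) (GL_product classes) empty_forest"
proof
  interpret CK: algebra_on "span_forests classes" "CK_dual_product classes" empty_forest
    by (rule CK_dual_algebra)
  note lin_l = linear_bilinear_extend_left [of "GL_basis classes"]
    and lin_r = linear_bilinear_extend_right [of "GL_basis classes"]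
  \<comment> \<open>Unit laws and associativity are checked after applying the injective map
    \<open>A_sigma\<close>; bilinearity comes directly from the definition of the product.\<close>
  have eqI: "u = v" if "A_sigma u = A_sigma v" "u \<in> span_forests classes" "v \<in> span_forests classes" for u v
    using that bij_betw_A_sigma by (auto simp: bij_betw_def dest: inj_onD)
  have closed: "GL_product classes u v \<in> span_forests classes"
    if "u \<in> span_forests classes" "v \<in> span_forests classes" for u v
    unfolding GL_product_def
  proof (rule bilinear_extend_in_subspace [OF subspace_span_forests that])
    show "GL_basis classes p q \<in> span_forests classes" if "p \<in> classes" "q \<in> classes" for p q
      using that by (auto simp: span_forests_def in_keys_iff lookup_GL_basis split: if_splits)
  qed
  note A = A_sigma_GL_product A_sigma_in_span closed
  show "subspace (span_forests classes)"
    by (rule subspace_span_forests)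
  show unit: "empty_forest \<in> span_forests classes"
    by (rule CK.unit_closed)
  fix x y z :: "'d forest \<Rightarrow>\<^sub>0 real" and c :: real
  assume x: "x \<in> span_forests classes"
  show "GL_product classes empty_forest x = x" "GL_product classes x empty_forest = x"
    by (rule eqI; simp add: A x unit A_sigma_unit CK.mult_unit_left CK.mult_unit_right)+
  assume y: "y \<in> span_forests classes"
  show "GL_product classes x y \<in> span_forests classes"
    using x y by (rule closed)
  show "GL_product classes (c *\<^sub>R x) y = c *\<^sub>R GL_product classes x y"
    and "GL_product classes x (c *\<^sub>R y) = c *\<^sub>R GL_product classes x y"
    by (simp_all add: GL_product_def bilinear_extend_scale_left bilinear_extend_scale_right)
  assume z: "z \<in> span_forests classes"
  show "GL_product classes (x + y) z = GL_product classes x z + GL_product classes y z"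
    and "GL_product classes x (y + z) = GL_product classes x y + GL_product classes x z"
    unfolding GL_product_def using linear_add [OF lin_l] linear_add [OF lin_r] by simp_all
  show "GL_product classes (GL_product classes x y) z = GL_product classes x (GL_product classes y z)"
    by (rule eqI) (simp_all add: A x y z CK.mult_assoc)
qed

lemma A_sigma_isomorphism:
  "algebra_isomorphism
     (span_forests classes) (GL_product classes) empty_forest
     (span_forests classes) (CK_dual_product classes) empty_forest A_sigma"
  by (intro algebra_isomorphism.intro GL_algebra CK_dual_algebra algebra_isomorphism_axioms.intro
      linear_add [OF linear_A_sigma] linear_scale [OF linear_A_sigma]
      bij_betw_A_sigma A_sigma_GL_product A_sigma_unit)

end

section \<open>Stability of the three kinds of forests under isomorphisms and cuts\<close>

lemma aromatic_forest_empty_graph: "aromatic_forest empty_graph"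
  by (simp add: aromatic_forest_def)

lemma CK_subset_pieces:
  assumes "S \<in> CK_subsets G" "T \<in> {S, verts G - S}"
  shows "T \<subseteq> verts G" "aromatic_forest (induced G T)"
  using assms by (auto simp: CK_subsets_def)

lemma dec_image_iso:
  assumes "iso_on \<phi> G H"
  shows "dec H ` verts H = dec G ` verts G"
proof -
  have "verts H = \<phi> ` verts G"
    using assms by (auto simp: iso_on_def bij_betw_def)
  then show ?thesis
    using assms by (force simp: iso_on_def)
qed

lemma grafted_forest_iso:
  assumes "grafted_forest G" "iso_on \<phi> G H"
  shows "grafted_forest H"
proof -
  have "edges G \<subseteq> verts G \<times> verts G"
    using assms(1) by (simp add: grafted_forest_def aromatic_forest_def)
  then show ?thesis
    using assms aromatic_forest_iso [OF _ assms(2)]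
    by (fastforce simp: grafted_forest_def iso_on_def)
qed

lemma grafted_forest_induced:
  "grafted_forest G \<Longrightarrow> aromatic_forest (induced G S) \<Longrightarrow> grafted_forest (induced G S)"
  by (auto simp: grafted_forest_def)

text \<open>Injectivity keeps the blocks disjoint and of size two.\<close>

lemma perfect_matching_image:
  assumes "perfect_matching A M" "inj_on \<phi> A"
  shows "perfect_matching (\<phi> ` A) ((\<lambda>l. \<phi> ` l) ` M)"
  unfolding perfect_matching_def
proof
  have M: "partition_on A M" "\<And>l. l \<in> M \<Longrightarrow> card l = 2"
    using assms(1) by (auto simp: perfect_matching_def)
  have sub: "l \<subseteq> A" if "l \<in> M" for l
    using that M(1) by (auto simp: partition_on_def)
  show "partition_on (\<phi> ` A) ((\<lambda>l. \<phi> ` l) ` M)"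
  proof (rule partition_onI)
    show "\<Union> ((\<lambda>l. \<phi> ` l) ` M) = \<phi> ` A"
      using M(1) by (auto simp: partition_on_def)
    show "disjnt p q" if pq: "p \<in> (\<lambda>l. \<phi> ` l) ` M" "q \<in> (\<lambda>l. \<phi> ` l) ` M" "p \<noteq> q" for p q
    proof -
      obtain a b where ab: "a \<in> M" "b \<in> M" "p = \<phi> ` a" "q = \<phi> ` b" "a \<noteq> b"
        using pq by auto
      then have "a \<inter> b = {}"
        using M(1) by (auto simp: partition_on_def disjoint_def)
      then show ?thesis
        using inj_on_image_Int [OF assms(2) sub [OF ab(1)] sub [OF ab(2)]] ab by (simp add: disjnt_def)
    qed
    show "{} \<notin> (\<lambda>l. \<phi> ` l) ` M"
      using M(1) by (auto simp: partition_on_def)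
  qed
  show "\<forall>l\<in>(\<lambda>l. \<phi> ` l) ` M. card l = 2"
    using M(2) card_image inj_on_subset [OF assms(2) sub] by fastforce
qed

text \<open>Here the rule that no liana is cut enters: a liana with only one end in \<open>S\<close>
  would leave that end unmatched.\<close>

lemma perfect_matching_restrict:
  assumes "perfect_matching A M" "\<And>l. l \<in> M \<Longrightarrow> l \<subseteq> S \<or> l \<inter> S = {}"
  shows "perfect_matching (A \<inter> S) {l \<in> M. l \<subseteq> S}"
  unfolding perfect_matching_def
proof
  have M: "partition_on A M" "\<And>l. l \<in> M \<Longrightarrow> card l = 2"
    using assms(1) by (auto simp: perfect_matching_def)
  show "partition_on (A \<inter> S) {l \<in> M. l \<subseteq> S}"
  proof (rule partition_onI)
    show "\<Union> {l \<in> M. l \<subseteq> S} = A \<inter> S"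
      using M(1) assms(2) unfolding partition_on_def by blast
  qed (use M(1) in \<open>auto simp: partition_on_def disjoint_def disjnt_def\<close>)
  show "\<forall>l\<in>{l \<in> M. l \<subseteq> S}. card l = 2"
    using M(2) by simp
qed

definition exotic_forest :: "('v, vertex_kind) dgraph \<Rightarrow> bool" where
  "exotic_forest G \<longleftrightarrow> grafted_forest G \<and> perfect_matching {v \<in> verts G. dec G v = Cross} (lianas G)"

text \<open>The blocks of a partition are nonempty subsets of the grafted vertices, which gives the
  conditions on lianas in \<open>proper\<close>.\<close>

lemma exotic_forest_proper: "exotic_forest G \<Longrightarrow> proper G"
  by (auto simp: exotic_forest_def proper_def grafted_forest_def perfect_matching_def partition_on_def)

lemma exotic_forest_iso:
  assumes G: "exotic_forest G" and \<phi>: "iso_on \<phi> G H"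
  shows "exotic_forest H"
proof -
  have b: "inj_on \<phi> (verts G)" "verts H = \<phi> ` verts G" and l: "lianas H = (\<lambda>l. \<phi> ` l) ` lianas G"
    and d: "\<And>v. v \<in> verts G \<Longrightarrow> dec G v = dec H (\<phi> v)"
    using \<phi> by (auto simp: iso_on_def bij_betw_def)
  let ?X = "{v \<in> verts G. dec G v = Cross}"
  have "{v \<in> verts H. dec H v = Cross} = \<phi> ` ?X"
    using d by (auto simp: b(2))
  moreover have "inj_on \<phi> ?X"
    using b(1) by (rule inj_on_subset) auto
  ultimately show ?thesis
    using G grafted_forest_iso [OF _ \<phi>] perfect_matching_image [of ?X "lianas G" \<phi>]
    by (simp add: exotic_forest_def l)
qed

lemma exotic_forest_piece:
  assumes G: "exotic_forest G" and S: "S \<in> CK_subsets G" and T: "T \<in> {S, verts G - S}"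
  shows "exotic_forest (induced G T)"
proof -
  \<comment> \<open>The cut condition on lianas is symmetric in \<open>S\<close> and its complement,
    so both pieces are treated at once.\<close>
  have "l \<subseteq> T \<or> l \<inter> T = {}" if "l \<in> lianas G" for l
    using that S T by (auto simp: CK_subsets_def)
  then have "perfect_matching ({v \<in> verts G. dec G v = Cross} \<inter> T) {l \<in> lianas G. l \<subseteq> T}"
    using G by (intro perfect_matching_restrict) (auto simp: exotic_forest_def)
  moreover have "{v \<in> verts G. dec G v = Cross} \<inter> T = {v \<in> T. dec G v = Cross}"
    using CK_subset_pieces(1) [OF S T] by blast
  ultimately show ?thesis
    using G grafted_forest_induced CK_subset_pieces(2) [OF S T] by (auto simp: exotic_forest_def)
qed

theorem proposition3p7:
  fixes D :: "'d set"
  shows "algebra_isomorphism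
           (span_forests (AF D)) (GL_product (AF D)) empty_forest
           (span_forests (AF D)) (CK_dual_product (AF D)) empty_forest A_sigma \<and>
         algebra_isomorphism
           (span_forests AFg) (GL_product AFg) empty_forest
           (span_forests AFg) (CK_dual_product AFg) empty_forest A_sigma \<and>
         algebra_isomorphism
           (span_forests EF) (GL_product EF) empty_forest
           (span_forests EF) (CK_dual_product EF) empty_forest A_sigma"
proof (intro conjI)
  \<comment> \<open>For each of the three spaces it remains to verify the conditions of
    \<open>forest_class\<close> and to identify \<open>classes\<close> with the given basis.\<close>
  interpret AF: forest_class "\<lambda>G. aromatic_forest G \<and> dec G ` verts G \<subseteq> D \<and> lianas G = {}"
  proof
    fix G H :: "(nat, 'd) dgraph" and \<phi> :: "nat \<Rightarrow> nat" and S :: "nat set"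
    assume G: "aromatic_forest G \<and> dec G ` verts G \<subseteq> D \<and> lianas G = {}"
    then show "proper G"
      by (simp add: proper_def)
    show "aromatic_forest H \<and> dec H ` verts H \<subseteq> D \<and> lianas H = {}" if "iso_on \<phi> G H"
      using G aromatic_forest_iso [OF _ that] dec_image_iso [OF that] that [unfolded iso_on_def] by simp
    assume S: "S \<in> CK_subsets G"
    have "aromatic_forest (induced G T) \<and> dec (induced G T) ` verts (induced G T) \<subseteq> D \<and> lianas (induced G T) = {}"
      if "T \<in> {S, verts G - S}" for T
      using CK_subset_pieces [OF S that] G by auto
    from this [of S] this [of "verts G - S"] show "(aromatic_forest (induced G S) \<and> dec (induced G S) ` verts (induced G S) \<subseteq> D \<and> lianas (induced G S) = {}) \<and>
        (aromatic_forest (induced G (verts G - S)) \<and> dec (induced G (verts G - S)) ` verts (induced G (verts G - S)) \<subseteq> D \<and>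
         lianas (induced G (verts G - S)) = {})"
      by simp
  qed (simp add: aromatic_forest_empty_graph)
  have "AF.classes = AF D"
    by (simp add: AF.classes_def AF_def)
  with AF.A_sigma_isomorphism show "algebra_isomorphism
      (span_forests (AF D)) (GL_product (AF D)) empty_forest
      (span_forests (AF D)) (CK_dual_product (AF D)) empty_forest A_sigma"
    by simp
next
  interpret AFg: forest_class "\<lambda>G. grafted_forest G \<and> lianas G = {}"
  proof
    fix G H :: "(nat, vertex_kind) dgraph" and \<phi> :: "nat \<Rightarrow> nat" and S :: "nat set"
    assume G: "grafted_forest G \<and> lianas G = {}"
    then show "proper G"
      by (simp add: proper_def grafted_forest_def)
    show "grafted_forest H \<and> lianas H = {}" if "iso_on \<phi> G H"
      using G grafted_forest_iso [OF _ that] that [unfolded iso_on_def] by simp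
    assume S: "S \<in> CK_subsets G"
    have "grafted_forest (induced G T) \<and> lianas (induced G T) = {}" if "T \<in> {S, verts G - S}" for T
      using CK_subset_pieces [OF S that] G by (simp add: grafted_forest_induced)
    from this [of S] this [of "verts G - S"] show "(grafted_forest (induced G S) \<and> lianas (induced G S) = {}) \<and>
        (grafted_forest (induced G (verts G - S)) \<and> lianas (induced G (verts G - S)) = {})"
      by simp
  qed (simp add: grafted_forest_def aromatic_forest_empty_graph)
  have "AFg.classes = AFg"
    by (simp add: AFg.classes_def AFg_def)
  with AFg.A_sigma_isomorphism show "algebra_isomorphism
      (span_forests AFg) (GL_product AFg) empty_forest
      (span_forests AFg) (CK_dual_product AFg) empty_forest A_sigma"
    by simp
next
  interpret EF: forest_class exotic_forest
  proof
    show "exotic_forest empty_graph"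
      by (simp add: exotic_forest_def grafted_forest_def aromatic_forest_empty_graph
          perfect_matching_def partition_on_empty)
  qed (auto intro: exotic_forest_proper exotic_forest_iso exotic_forest_piece)
  have "EF.classes = EF"
    by (simp add: EF.classes_def EF_def exotic_forest_def)
  with EF.A_sigma_isomorphism show "algebra_isomorphism
      (span_forests EF) (GL_product EF) empty_forest
      (span_forests EF) (CK_dual_product EF) empty_forest A_sigma"
    by simp
qed

end
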